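(* Let $l\ge 1$ be a natural number and let $K_l\subset\mathbb{R}$ be the Cantorval $$K_l=\left\{\sum_{i=1}^{\infty}\frac{\varepsilon_i}{(2l+2)^i} : (\varepsilon_i)_{i\ge 1}\in T_l^{\mathbb{N}}\right\},\qquad T_l=\{0,2,4,\dots,2l\}\cup\{2l+1,2l+3,\dots,4l+1\}.$$ Then the Lebesgue measure of $K_l$ is equal to $1$, and the topological boundary of $K_l$ has non-integer Hausdorff dimension equal to $\dfrac{\log(2l+1)}{\log(2l+2)}$.
   Context: $T_l$ has $2l+2$ elements: the even integers from $0$ to $2l$ and the odd integers from $2l+1$ to $4l+1$. The boundary of $K_l$ is $K_l\setminus \mathrm{int}(K_l)$, the interior being taken in $\mathbb{R}$. A Cantorval (M-Cantorval) is a subset of $\mathbb{R}$ homeomorphic to $C\cup\bigcup_{n=1}^{\infty}G_{2n-1}$ (equivalently $[0,1]\setminus\bigcup_{n=1}^\infty G_{2n}$), where $C$ is the Cantor ternary set and $G_n$ is the union of the $2^{n-1}$ open middle thirds removed from $[0,1]$ at the $n$-th step of the construction of $C$. *)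

theory Defs
  imports "HOL-Analysis.Analysis"
begin

text \<open>\<open>cantor_stage n\<close> is the set of pairs \<open>(a, b)\<close> such that \<open>[a, b]\<close> is one of the
  \<open>2 ^ n\<close> closed intervals left after \<open>n\<close> steps of the ternary construction.\<close>

primrec cantor_stage :: "nat \<Rightarrow> (real \<times> real) set" where
  "cantor_stage 0 = {(0, 1)}"
| "cantor_stage (Suc n) =
     (\<Union>(a, b)\<in>cantor_stage n. {(a, a + (b - a) / 3), (b - (b - a) / 3, b)})"

definition cantor_ternary :: "real set" where
  "cantor_ternary = (\<Inter>n. \<Union>(a, b)\<in>cantor_stage n. {a..b})"

text \<open>The steps are numbered from 1: \<open>cantor_gap n\<close> is obtained from the intervals left after
  \<open>n - 1\<close> steps, and is only meaningful for \<open>n \<ge> 1\<close>.\<close>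

definition cantor_gap :: "nat \<Rightarrow> real set" where
  "cantor_gap n = (\<Union>(a, b)\<in>cantor_stage (n - 1). {a + (b - a) / 3 <..< b - (b - a) / 3})"

definition is_cantorval :: "real set \<Rightarrow> bool" where
  "is_cantorval X \<longleftrightarrow>
     X homeomorphic (cantor_ternary \<union> (\<Union>n\<in>{1..}. cantor_gap (2 * n - 1)))"

text \<open>Here \<open>diam(U)^0\<close> is 1 for nonempty \<open>U\<close>. The case \<open>s = 0\<close> is separate because
  \<open>0 powr 0 = 0\<close> in HOL.\<close>

definition diam_pow :: "real \<Rightarrow> 'a::metric_space set \<Rightarrow> real" where
  "diam_pow s U = (if U = {} then 0 else if s = 0 then 1 else diameter U powr s)"

text \<open>Boundedness of the covering sets is required explicitly because \<open>diameter\<close> is an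
  unspecified real number on unbounded sets. Finite covers are included, since members of the
  covering sequence may be empty.\<close>

definition hausdorff_content :: "real \<Rightarrow> real \<Rightarrow> 'a::metric_space set \<Rightarrow> ennreal" where
  "hausdorff_content \<delta> s A =
     Inf {(\<Sum>i. ennreal (diam_pow s (U i))) | U :: nat \<Rightarrow> 'a set.
            A \<subseteq> (\<Union>i. U i) \<and> (\<forall>i. bounded (U i) \<and> diameter (U i) \<le> \<delta>)}"

definition hausdorff_measure :: "real \<Rightarrow> 'a::metric_space set \<Rightarrow> ennreal" where
  "hausdorff_measure s A = (SUP \<delta>\<in>{0<..}. hausdorff_content \<delta> s A)"

definition hausdorff_dim :: "'a::metric_space set \<Rightarrow> ereal" where
  "hausdorff_dim A = Inf {ereal s | s. 0 \<le> s \<and> hausdorff_measure s A = 0}"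

definition T :: "nat \<Rightarrow> nat set" where
  "T l = {t. even t \<and> t \<le> 2 * l} \<union> {t. odd t \<and> 2 * l + 1 \<le> t \<and> t \<le> 4 * l + 1}"

text \<open>The digit \<open>\<epsilon> i\<close> here is the coefficient of \<open>(2 l + 2)^-(i + 1)\<close>. The series always
  converges because \<open>T l\<close> is bounded.\<close>

definition K :: "nat \<Rightarrow> real set" where
  "K l = {(\<Sum>i. real (\<epsilon> i) / real (2 * l + 2) ^ Suc i) | \<epsilon> :: nat \<Rightarrow> nat. \<forall>i. \<epsilon> i \<in> T l}"

end

theory Submission
  imports Defs
begin

text \<open>
  Write \<open>b = 2 l + 2\<close> and \<open>H = 2 l / (2 l + 1)\<close>. The digits \<open>T l\<close> form a complete residue system
  modulo \<open>b\<close>, so the integer translates of \<open>K l\<close> cover the line. As \<open>K l\<close> lies in \<open>[0, 1 + H]\<close>,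
  the interval \<open>(H, 1)\<close> meets no other translate and is contained in \<open>K l\<close>. Zooming into \<open>K l\<close>, one
  sees copies of \<open>K l\<close> and of \<open>K l - 1\<close> inside \<open>[0, H]\<close>. With \<open>C\<close> the Cantor set of all numbers
  whose base \<open>b\<close> digits avoid \<open>b - 1\<close>, it follows that \<open>K l\<close> is \<open>[0, 1 + H]\<close> minus those gaps of
  \<open>C \<union> (1 + C)\<close> for which the digits up to the one after which the gap opens (units included)
  have an odd sum.

  The boundary of \<open>K l\<close> is therefore \<open>C \<union> (1 + C)\<close>. Its dimension is bounded above by the obvious covers,
  and below since reading the digits in base \<open>b - 1\<close> maps \<open>C\<close> onto \<open>[0, 1]\<close> with Hoelder
  exponent \<open>log (2 l + 1) / log (2 l + 2)\<close>. The overlap of \<open>K l\<close> and \<open>K l - 1\<close> is null by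
  self-similarity, so \<open>K l\<close> has the measure of a fundamental domain. Finally, the gaps of a Cantor
  set in two colours, both accumulating at every point of the set, are determined up to a
  colour-preserving order isomorphism, which extends to a homeomorphism of the line; this
  identifies \<open>K l\<close> with the model built from the ternary Cantor set.
\<close>

section \<open>Order isomorphisms of coloured gaps\<close>

text \<open>The extension sends \<open>x\<close> to the supremum of \<open>f\<close> over the points
  of \<open>U\<close> up to \<open>x\<close>. Density of \<open>U\<close> keeps it strictly
  increasing; density of the image leaves no jumps, hence surjectivity.\<close>

lemma dense_order_extension:
  fixes f :: "real \<Rightarrow> real"
  assumes mono: "strict_mono_on U f"
    and U: "\<And>x y. x < y \<Longrightarrow> \<exists>u\<in>U. x < u \<and> u < y"
    and V: "\<And>x y. x < y \<Longrightarrow> \<exists>u\<in>U. x < f u \<and> f u < y"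
  obtains F where "strict_mono F" "surj F" "\<And>u. u \<in> U \<Longrightarrow> F u = f u"
proof
  define F where "F x = Sup (f ` {u \<in> U. u \<le> x})" for x
  have less: "f u < f v \<longleftrightarrow> u < v" if "u \<in> U" "v \<in> U" for u v
    using strict_mono_on_less[OF mono that] .
  have le: "f u \<le> f v \<longleftrightarrow> u \<le> v" if "u \<in> U" "v \<in> U" for u v
    using strict_mono_on_less_eq[OF mono that] .
  show eq: "F u = f u" if "u \<in> U" for u
    unfolding F_def using that le by (intro cSup_eq_maximum) auto
  have ne: "f ` {u \<in> U. u \<le> x} \<noteq> {}" for x
    using U[of "x - 1" x] by force
  have upper: "F x \<le> f u" if "u \<in> U" "x < u" for x u
    unfolding F_def using ne that le by (intro cSup_least) auto
  have lower: "f u \<le> F x" if "u \<in> U" "u \<le> x" for x u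
  proof -
    obtain v where "v \<in> U" "x < v" using U[of x "x + 1"] by auto
    then have "bdd_above (f ` {u \<in> U. u \<le> x})"
      by (intro bdd_aboveI[of _ "f v"]) (auto simp: le)
    then show ?thesis unfolding F_def using that by (intro cSup_upper) auto
  qed
  show sm: "strict_mono F"
  proof (rule strict_monoI)
    fix x y :: real assume "x < y"
    obtain u where u: "u \<in> U" "x < u" "u < y" using U[OF \<open>x < y\<close>] by blast
    obtain v where v: "v \<in> U" "u < v" "v < y" using U[OF u(3)] by blast
    have "F x \<le> f u" "f u < f v" "f v \<le> F y"
      using u v upper lower less by auto
    then show "F x < F y" by linarith
  qed
  show "surj F"
  proof (rule surjI)
    fix y
    define A where "A = {u \<in> U. f u \<le> y}"
    define x where "x = Sup A"
    have ne: "A \<noteq> {}" using V[of "y - 1" y] unfolding A_def by force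
    obtain v where v: "v \<in> U" "y < f v" using V[of y "y + 1"] by auto
    have bdd: "bdd_above A"
      using v less unfolding A_def by (intro bdd_aboveI[of _ v]) (fastforce simp flip: le)
    show "F (Sup {u \<in> U. f u \<le> y}) = y"
    proof (rule antisym; rule ccontr)
      assume "\<not> F (Sup {u \<in> U. f u \<le> y}) \<le> y"
      then obtain u where u: "u \<in> U" "y < f u" "f u < F x"
        using V[of y "F x"] by (auto simp: x_def A_def)
      then have "u < x" using eq sm by (metis strict_mono_less)
      then obtain w where "w \<in> A" "u < w" using less_cSup_iff[OF ne bdd] x_def by blast
      then have "f u < y" using u less[of u w] by (auto simp: A_def)
      with u show False by simp
    next
      assume "\<not> y \<le> F (Sup {u \<in> U. f u \<le> y})"
      then obtain u where u: "u \<in> U" "F x < f u" "f u < y"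
        using V[of "F x" y] by (auto simp: x_def A_def)
      then have "x < u" using eq sm by (metis strict_mono_less)
      moreover have "u \<le> x" unfolding x_def using u bdd by (intro cSup_upper) (auto simp: A_def)
      ultimately show False by simp
    qed
  qed
qed

text \<open>Order alone gives continuity: a monotone map with full range cannot jump, and the
  inverse is again monotone with full range.\<close>

lemma strict_mono_surj_homeomorphism:
  fixes F :: "real \<Rightarrow> real"
  assumes mono: "strict_mono F" and surj: "surj F"
  shows "homeomorphism UNIV UNIV F (inv F)"
proof -
  have inj: "inj F" by (rule strict_mono_imp_inj_on[OF mono])
  have FG: "F (inv F y) = y" for y by (rule surj_f_inv_f[OF surj])
  have GF: "inv F (F x) = x" for x by (rule inv_f_f[OF inj])
  have surj': "surj (inv F)" by (rule inj_imp_surj_inv[OF inj])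
  have "inv F x \<le> inv F y" if "x \<le> y" for x y
    using that strict_mono_less_eq[OF mono, of "inv F x" "inv F y"] by (simp add: FG)
  then have "continuous_on UNIV (inv F)" by (intro continuous_onI_mono) (simp_all add: surj')
  moreover have "continuous_on UNIV F"
    using strict_mono_less_eq[OF mono] surj by (intro continuous_onI_mono) simp_all
  ultimately show ?thesis
    by (intro homeomorphismI) (simp_all add: FG GF)
qed

text \<open>Both families are arranged along the line in the same order \<open>prec\<close>, so the
  maps between corresponding pieces glue to one increasing map from a dense set onto a dense
  set.\<close>

lemma piecewise_extension:
  fixes prec :: "'i \<Rightarrow> 'i \<Rightarrow> bool" and P P' :: "'i \<Rightarrow> real set" and \<phi> :: "'i \<Rightarrow> real \<Rightarrow> real"
  assumes linear: "\<And>i j. i = j \<or> prec i j \<or> prec j i"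
    and below: "\<And>i j u v. prec i j \<Longrightarrow> u \<in> P i \<Longrightarrow> v \<in> P j \<Longrightarrow> u < v"
    and below': "\<And>i j u v. prec i j \<Longrightarrow> u \<in> P' i \<Longrightarrow> v \<in> P' j \<Longrightarrow> u < v"
    and mono: "\<And>i. strict_mono_on (P i) (\<phi> i)"
    and onto: "\<And>i. \<phi> i ` P i = P' i"
    and dense: "\<And>x y. x < y \<Longrightarrow> \<exists>u \<in> (\<Union>i. P i). x < u \<and> u < y"
    and dense': "\<And>x y. x < y \<Longrightarrow> \<exists>u \<in> (\<Union>i. P' i). x < u \<and> u < y"
  shows "\<exists>F. strict_mono F \<and> surj F \<and> (\<forall>i. F ` P i = P' i)"
proof -
  define f where "f u = \<phi> (SOME i. u \<in> P i) u" for u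
  have f: "f u = \<phi> i u" if "u \<in> P i" for u i
  proof -
    \<comment> \<open>Distinct pieces are disjoint by \<open>below\<close>, so the choice is
      forced.\<close>
    have "(SOME i. u \<in> P i) = i"
    proof (rule some_equality[where P = "\<lambda>i. u \<in> P i"])
      fix j assume "u \<in> P j"
      then show "j = i" using linear[of i j] below that by (meson less_irrefl)
    qed fact
    then show ?thesis by (simp add: f_def)
  qed
  have image: "f ` P i = P' i" for i
    using onto[of i] f[of _ i] by (simp cong: image_cong)
  have "strict_mono_on (\<Union>i. P i) f"
  proof (rule strict_mono_onI)
    fix u v assume "u \<in> (\<Union>i. P i)" "v \<in> (\<Union>i. P i)" "u < v"
    then obtain i j where ij: "u \<in> P i" "v \<in> P j" by blast
    consider "i = j" | "prec i j" | "prec j i" using linear by blast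
    then show "f u < f v"
    proof cases
      case 1
      then show ?thesis
        using strict_mono_onD[OF mono[of i], of u v] ij f[of u i] f[of v i] \<open>u < v\<close> by simp
    next
      case 2
      have "f u \<in> P' i" "f v \<in> P' j" using image ij by blast+
      then show ?thesis by (rule below'[OF 2])
    next
      case 3
      then show ?thesis using below[OF 3 ij(2,1)] \<open>u < v\<close> by simp
    qed
  qed
  moreover have "\<exists>u \<in> (\<Union>i. P i). x < f u \<and> f u < y" if xy: "x < y" for x y
  proof -
    obtain i w where "w \<in> P' i" "x < w" "w < y" using dense'[OF xy] by blast
    moreover then obtain u where "u \<in> P i" "w = f u" using image[of i] by blast
    ultimately show ?thesis by blast
  qed
  ultimately obtain F where F: "strict_mono F" "surj F" "\<And>u. u \<in> (\<Union>i. P i) \<Longrightarrow> F u = f u"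
    using dense_order_extension[of "\<Union>i. P i" f] dense by metis
  then have "F ` P i = P' i" for i
    using image[of i] by (metis (no_types, lifting) UNIV_I UN_I image_cong)
  with F show ?thesis by blast
qed

definition interpolate :: "real \<Rightarrow> real \<Rightarrow> real \<Rightarrow> real \<Rightarrow> real \<Rightarrow> real" where
  "interpolate a b a' b' u = a' + (u - a) * ((b' - a') / (b - a))"

lemma interpolate_less:
  "a < b \<Longrightarrow> a' < b' \<Longrightarrow> u < v \<Longrightarrow> interpolate a b a' b' u < interpolate a b a' b' v"
  unfolding interpolate_def
  by (intro add_strict_left_mono mult_strict_right_mono) simp_all

lemma interpolate_image:
  assumes "a < b" "a' < b'"
  shows "interpolate a b a' b' ` {a<..<b} = {a'<..<b'}"
proof (intro equalityI subsetI)
  have ends: "interpolate x y x' y' x = x'" "interpolate x y x' y' y = y'" if "x < y" for x y x' y'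
    using that by (simp_all add: interpolate_def)
  have maps: "interpolate x y x' y' u \<in> {x'<..<y'}" if "x < y" "x' < y'" "u \<in> {x<..<y}" for x y x' y' u
    using interpolate_less[of x y x' y' x u] interpolate_less[of x y x' y' u y] ends that by auto
  show "v \<in> {a'<..<b'}" if "v \<in> interpolate a b a' b' ` {a<..<b}" for v
    using that maps assms by blast
  show "v \<in> interpolate a b a' b' ` {a<..<b}" if "v \<in> {a'<..<b'}" for v
  proof
    show "v = interpolate a b a' b' (interpolate a' b' a b v)"
      using assms by (simp add: interpolate_def)
    show "interpolate a' b' a b v \<in> {a<..<b}" using maps assms that by blast
  qed
qed

text \<open>The in-order on the nodes of the infinite binary tree. A word is the path from the root,
  \<open>True\<close> standing for a turn to the right.\<close>

fun tree_less :: "bool list \<Rightarrow> bool list \<Rightarrow> bool" where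
  "tree_less [] [] = False"
| "tree_less [] (b # q) = b"
| "tree_less (a # p) [] = (\<not> a)"
| "tree_less (a # p) (b # q) = (if a = b then tree_less p q else b)"

lemma tree_less_linear: "p = q \<or> tree_less p q \<or> tree_less q p"
proof (induction p q rule: tree_less.induct)
  case (4 a p b q)
  then show ?case by (cases "a = b"; cases b; simp)
qed simp_all

datatype position = Low | High | Gap "bool list"

fun position_less :: "position \<Rightarrow> position \<Rightarrow> bool" where
  "position_less Low j \<longleftrightarrow> j \<noteq> Low"
| "position_less High j \<longleftrightarrow> False"
| "position_less (Gap p) j \<longleftrightarrow> (case j of Low \<Rightarrow> False | High \<Rightarrow> True | Gap q \<Rightarrow> tree_less p q)"

lemma position_less_linear: "i = j \<or> position_less i j \<or> position_less j i"
  using tree_less_linear by (cases i; cases j) auto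

text \<open>The gaps form a countable dense order without end points in which each colour is dense,
  the situation of Cantor's isomorphism theorem. \<open>gap_after\<close> is one-sided because every
  interval searched below begins at \<open>L\<close> or at the right end of a gap.\<close>

locale coloured_gaps =
  fixes G :: "'a set" and lf rt :: "'a \<Rightarrow> real" and col :: "'a \<Rightarrow> bool" and L R :: real
  assumes countable_gaps: "countable G"
    and gap_nonempty: "g \<in> G \<Longrightarrow> lf g < rt g"
    and gap_inside: "g \<in> G \<Longrightarrow> L < lf g \<and> rt g < R"
    and gap_sep: "g \<in> G \<Longrightarrow> h \<in> G \<Longrightarrow> g \<noteq> h \<Longrightarrow> rt g < lf h \<or> rt h < lf g"
    and gap_after: "x \<in> insert L (rt ` G) \<Longrightarrow> x < y \<Longrightarrow> \<exists>g\<in>G. col g = c \<and> x < lf g \<and> rt g < y"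
    and gaps_dense: "L \<le> x \<Longrightarrow> x < y \<Longrightarrow> y \<le> R \<Longrightarrow> \<exists>g\<in>G. lf g < y \<and> x < rt g"
    and L_less_R: "L < R"
begin

section \<open>Indexing the gaps of one configuration by a binary tree\<close>

abbreviation fits :: "bool \<Rightarrow> real \<Rightarrow> real \<Rightarrow> 'a \<Rightarrow> bool" where
  "fits c x y g \<equiv> g \<in> G \<and> col g = c \<and> x < lf g \<and> rt g < y"

definition pick :: "bool \<Rightarrow> real \<Rightarrow> real \<Rightarrow> 'a" where
  "pick c x y = arg_min (to_nat_on G) (fits c x y)"

text \<open>A binary tree of gaps, the colours alternating with the depth. Picking the gap of least index
  among those of the right colour makes sure that every gap is picked.\<close>

fun node :: "bool \<Rightarrow> real \<Rightarrow> real \<Rightarrow> bool list \<Rightarrow> 'a" where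
  "node c x y [] = pick c x y"
| "node c x y (b # p) =
    (if b then node (\<not> c) (rt (pick c x y)) y p else node (\<not> c) x (lf (pick c x y)) p)"

definition slot :: "real \<Rightarrow> real \<Rightarrow> bool" where
  "slot x y \<longleftrightarrow> x \<in> insert L (rt ` G) \<and> x < y"

lemma pick_fits:
  assumes "slot x y"
  shows "fits c x y (pick c x y)"
proof -
  obtain g where "fits c x y g" using gap_after[of x y c] assms unfolding slot_def by blast
  then show ?thesis unfolding pick_def by (rule arg_min_natI[where P = "fits c x y"])
qed

lemma pick_least: "fits c x y g \<Longrightarrow> to_nat_on G (pick c x y) \<le> to_nat_on G g"
  unfolding pick_def by (rule arg_min_nat_le[where P = "fits c x y"])

lemma slot_pick:
  assumes "slot x y"
  shows "slot x (lf (pick c x y))" "slot (rt (pick c x y)) y"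
  using assms pick_fits[OF assms, of c] unfolding slot_def by blast+

lemma node_in_slot:
  "slot x y \<Longrightarrow> node c x y p \<in> G \<and> x < lf (node c x y p) \<and> rt (node c x y p) < y"
proof (induction p arbitrary: c x y)
  case (Cons b p)
  note IH = Cons.IH[OF slot_pick(1)[OF Cons.prems, of c], of "\<not> c"]
    Cons.IH[OF slot_pick(2)[OF Cons.prems, of c], of "\<not> c"]
  have "x < lf (pick c x y)" "lf (pick c x y) < rt (pick c x y)" "rt (pick c x y) < y"
    using pick_fits[OF Cons.prems, of c] gap_nonempty by auto
  with IH show ?case by (cases b; simp; linarith)
qed (use pick_fits in auto)

lemma col_node: "slot x y \<Longrightarrow> col (node c x y p) \<longleftrightarrow> (c = even (length p))"
proof (induction p arbitrary: c x y)
  case (Cons b p)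
  then show ?case using slot_pick[OF Cons.prems, of c] by auto
qed (use pick_fits in auto)

lemma node_tree_less:
  "slot x y \<Longrightarrow> tree_less p q \<Longrightarrow> rt (node c x y p) < lf (node c x y q)"
proof (induction p q arbitrary: c x y rule: tree_less.induct)
  case (2 b q)
  then show ?case using node_in_slot[OF slot_pick(2)[OF 2(1), of c], of "\<not> c" q] by simp
next
  case (3 a p)
  then show ?case using node_in_slot[OF slot_pick(1)[OF 3(1), of c], of "\<not> c" p] by simp
next
  case (4 a p b q)
  note sl = slot_pick[OF 4(2), of c]
  show ?case
  proof (cases "a = b")
    case True
    then show ?thesis using 4 sl by auto
  next
    case False
    then show ?thesis
      using 4(3) node_in_slot[OF sl(1), of "\<not> c" p] node_in_slot[OF sl(2), of "\<not> c" q]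
        pick_fits[OF 4(2), of c] gap_nonempty[of "pick c x y"] by auto
  qed
qed auto

text \<open>The measure is twice the number of gaps in the slot with smaller index than
  \<open>g\<close>, plus one if the colour now searched is not that of \<open>g\<close>. If the
  colours agree, the picked gap has smaller index than \<open>g\<close> and drops out of the slot;
  if they differ, the next level searches for the colour of \<open>g\<close>.\<close>

lemma node_surj:
  assumes "slot x y" "g \<in> G" "x < lf g" "rt g < y"
  shows "\<exists>p. node c x y p = g"
  using assms
proof (induction "2 * card {h \<in> G. x < lf h \<and> rt h < y \<and> to_nat_on G h < to_nat_on G g}
    + (if col g = c then 0 else 1)" arbitrary: c x y rule: less_induct)
  case less
  let ?C = "\<lambda>x y. {h \<in> G. x < lf h \<and> rt h < y \<and> to_nat_on G h < to_nat_on G g}"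
  have fin: "finite (?C x y)" for x y
    by (rule inj_on_finite[of "to_nat_on G" _ "{..< to_nat_on G g}"])
      (auto intro: inj_on_subset[OF inj_on_to_nat_on[OF countable_gaps]])
  define h where "h = pick c x y"
  have h: "fits c x y h" unfolding h_def by (rule pick_fits) fact
  then have hgap: "lf h < rt h" "x < lf h" "rt h < y" using gap_nonempty by auto
  note sl = slot_pick[OF less.prems(1), of c, folded h_def]
  show ?case
  proof (cases "g = h")
    case True
    then show ?thesis by (metis h_def node.simps(1))
  next
    case False
    have smaller: "2 * card (?C x' y') + (if col g = (\<not> c) then 0 else 1)
        < 2 * card (?C x y) + (if col g = c then 0 else (1::nat))"
      if sub: "?C x' y' \<subseteq> ?C x y" "h \<notin> ?C x' y'" for x' y'
    proof (cases "col g = c")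
      case True
      then have "to_nat_on G h \<le> to_nat_on G g"
        unfolding h_def using less.prems by (intro pick_least) auto
      moreover have "to_nat_on G h \<noteq> to_nat_on G g"
        using False h less.prems(2) inj_on_to_nat_on[OF countable_gaps] by (auto dest: inj_onD)
      ultimately have "h \<in> ?C x y" using h by auto
      then have "?C x' y' \<subset> ?C x y" using sub by blast
      then have "card (?C x' y') < card (?C x y)" by (rule psubset_card_mono[OF fin])
      then show ?thesis by auto
    next
      case False
      then show ?thesis using card_mono[OF fin sub(1)] by auto
    qed
    from gap_sep[OF less.prems(2) _ False] h
    consider "rt g < lf h" | "rt h < lf g" by blast
    then show ?thesis
    proof cases
      case 1
      have sub: "?C x (lf h) \<subseteq> ?C x y" "h \<notin> ?C x (lf h)" using hgap by auto
      have "\<exists>p. node (\<not> c) x (lf h) p = g"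
        by (rule less.hyps[OF smaller[OF sub] sl(1) less.prems(2,3) 1])
      then obtain p where "node c x y (False # p) = g" by (auto simp: h_def)
      then show ?thesis by blast
    next
      case 2
      have sub: "?C (rt h) y \<subseteq> ?C x y" "h \<notin> ?C (rt h) y" using hgap by auto
      have "\<exists>p. node (\<not> c) (rt h) y p = g"
        by (rule less.hyps[OF smaller[OF sub] sl(2) less.prems(2) 2 less.prems(4)])
      then obtain p where "node c x y (True # p) = g" by (auto simp: h_def)
      then show ?thesis by blast
    qed
  qed
qed

definition gap_at :: "bool list \<Rightarrow> 'a" where
  "gap_at = node True L R"

lemma slot_LR: "slot L R"
  using L_less_R by (simp add: slot_def)

lemma gap_at_in: "gap_at p \<in> G"
  using node_in_slot[OF slot_LR] by (simp add: gap_at_def)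

lemma col_gap_at: "col (gap_at p) = even (length p)"
  using col_node[OF slot_LR] by (simp add: gap_at_def)

lemma gap_at_less: "tree_less p q \<Longrightarrow> rt (gap_at p) < lf (gap_at q)"
  unfolding gap_at_def by (rule node_tree_less[OF slot_LR])

lemma gap_at_surj: "g \<in> G \<Longrightarrow> \<exists>p. gap_at p = g"
  using node_surj[OF slot_LR, of g] gap_inside[of g] by (simp add: gap_at_def)

lemma gap_at_nonempty: "lf (gap_at p) < rt (gap_at p)"
  and L_less_gap_at: "L < lf (gap_at p)"
  and gap_at_less_R: "rt (gap_at p) < R"
  using gap_nonempty gap_inside gap_at_in by auto

section \<open>Components of the complement and the classification up to homeomorphism\<close>

definition retained :: "real set" where
  "retained = {L..R} - (\<Union>g\<in>{g \<in> G. \<not> col g}. {lf g <..< rt g})"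

text \<open>The two unbounded components complete the gaps to a dense open subset of the line.\<close>

fun component :: "position \<Rightarrow> real set" where
  "component Low = {..<L}"
| "component High = {R<..}"
| "component (Gap p) = {lf (gap_at p) <..< rt (gap_at p)}"

lemma component_less:
  assumes "position_less i j" "u \<in> component i" "v \<in> component j"
  shows "u < v"
proof (cases i)
  case Low
  show ?thesis
  proof (cases j)
    case (Gap q)
    then show ?thesis using assms Low L_less_gap_at[of q] by simp
  qed (use assms Low L_less_R in simp_all)
next
  case High
  then show ?thesis using assms by simp
next
  case (Gap p)
  note i = Gap
  show ?thesis
  proof (cases j)
    case (Gap q)
    then show ?thesis using assms i gap_at_less[of p q] by simp
  qed (use assms i gap_at_less_R[of p] in simp_all)
qed

lemma components_dense:
  assumes "x < y"
  shows "\<exists>u \<in> (\<Union>i. component i). x < u \<and> u < y"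
proof -
  consider "x < L" | "R < y" | "L \<le> x" "y \<le> R" by linarith
  then show ?thesis
  proof cases
    case 1
    then obtain u where "x < u" "u < min y L" using assms dense[of x "min y L"] by auto
    then have "u \<in> component Low" "x < u" "u < y" by auto
    then show ?thesis by blast
  next
    case 2
    then obtain u where "max x R < u" "u < y" using assms dense[of "max x R" y] by auto
    then have "u \<in> component High" "x < u" "u < y" by auto
    then show ?thesis by blast
  next
    case 3
    then obtain g where g: "g \<in> G" "lf g < y" "x < rt g" using gaps_dense assms by blast
    obtain p where p: "gap_at p = g" using gap_at_surj g by blast
    have "max x (lf g) < min y (rt g)" using g assms gap_nonempty by auto
    then obtain u where u: "max x (lf g) < u" "u < min y (rt g)" using dense by blast
    then have "u \<in> component (Gap p)" "x < u" "u < y" by (auto simp: p)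
    then show ?thesis by blast
  qed
qed

text \<open>The root has colour \<open>True\<close> and colours alternate with depth, so the removed
  gaps are those at odd depth. This describes the set by positions alone, in the same way for every
  configuration.\<close>

lemma retained_eq_Compl:
  "retained = - (component Low \<union> component High \<union> (\<Union>p\<in>{p. odd (length p)}. component (Gap p)))"
proof -
  have "{g \<in> G. \<not> col g} = gap_at ` {p. odd (length p)}"
    using gap_at_surj gap_at_in col_gap_at by (fastforce simp: image_iff)
  then have "(\<Union>g\<in>{g \<in> G. \<not> col g}. {lf g <..< rt g}) = (\<Union>p\<in>{p. odd (length p)}. component (Gap p))"
    by simp
  then show ?thesis unfolding retained_def by auto
qed

end

text \<open>Components at equal positions are matched by translations or affine maps. The extension
  of these maps to the line respects positions, hence also the complement of the removed
  components.\<close>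

theorem retained_homeomorphic:
  assumes "coloured_gaps G lf rt col L R" "coloured_gaps G' lf' rt' col' L' R'"
  shows "coloured_gaps.retained G lf rt col L R homeomorphic
    coloured_gaps.retained G' lf' rt' col' L' R'"
proof -
  interpret A: coloured_gaps G lf rt col L R by fact
  interpret B: coloured_gaps G' lf' rt' col' L' R' by fact
  define \<phi> where "\<phi> i = (case i of Low \<Rightarrow> (\<lambda>u. u - L + L') | High \<Rightarrow> (\<lambda>u. u - R + R')
    | Gap p \<Rightarrow> interpolate (lf (A.gap_at p)) (rt (A.gap_at p)) (lf' (B.gap_at p)) (rt' (B.gap_at p)))" for i
  have mono: "strict_mono_on (A.component i) (\<phi> i)" for i
  proof (cases i)
    case (Gap p)
    show ?thesis
      using interpolate_less[OF A.gap_at_nonempty B.gap_at_nonempty]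
      by (intro strict_mono_onI) (simp add: Gap \<phi>_def)
  qed (simp_all add: \<phi>_def strict_mono_on_def)
  have onto: "\<phi> i ` A.component i = B.component i" for i
  proof (cases i)
    case Low
    have "(\<lambda>u. u - L + L') ` {..<L} = {..<L'}"
    proof (intro equalityI subsetI)
      fix v assume "v \<in> {..<L'}"
      then show "v \<in> (\<lambda>u. u - L + L') ` {..<L}"
        by (intro image_eqI[of _ _ "v - L' + L"]) auto
    qed auto
    then show ?thesis by (simp add: \<phi>_def Low)
  next
    case High
    have "(\<lambda>u. u - R + R') ` {R<..} = {R'<..}"
    proof (intro equalityI subsetI)
      fix v assume "v \<in> {R'<..}"
      then show "v \<in> (\<lambda>u. u - R + R') ` {R<..}"
        by (intro image_eqI[of _ _ "v - R' + R"]) auto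
    qed auto
    then show ?thesis by (simp add: \<phi>_def High)
  next
    case (Gap p)
    then show ?thesis
      using interpolate_image A.gap_at_nonempty B.gap_at_nonempty by (simp add: \<phi>_def)
  qed
  have "\<exists>F. strict_mono F \<and> surj F \<and> (\<forall>i. F ` A.component i = B.component i)"
    by (rule piecewise_extension[where prec = position_less and P = A.component and P' = B.component
          and \<phi> = \<phi>, OF position_less_linear A.component_less B.component_less mono onto
          A.components_dense B.components_dense])
  then obtain F where F: "strict_mono F" "surj F" "\<And>i. F ` A.component i = B.component i"
    by blast
  have "bij F" using F(1,2) by (simp add: bij_def strict_mono_imp_inj_on)
  then have "F ` A.retained = B.retained"
    unfolding A.retained_eq_Compl B.retained_eq_Compl
    by (subst bij_image_Compl_eq) (simp_all only: image_Un image_UN F(3))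
  then have "homeomorphism A.retained B.retained F (inv F)"
    by (rule homeomorphism_of_subsets[OF strict_mono_surj_homeomorphism[OF F(1,2)] subset_UNIV subset_UNIV])
  then show ?thesis unfolding homeomorphic_def by blast
qed

section \<open>Cantor sets with coloured gaps\<close>

text \<open>An interval of level \<open>n\<close> has length \<open>\<tau> n\<close>, and its \<open>maxd n + 1\<close> subintervals start at distance
  \<open>sp n\<close> from each other. It carries a flag \<open>c\<close>: its \<open>d\<close>-th subinterval inherits the flag
  \<open>step c d\<close>, and the gap after that subinterval has colour \<open>hue c d\<close>, where \<open>True\<close> means that the
  gap is filled in.\<close>

locale cantor_scheme =
  fixes maxd :: "nat \<Rightarrow> nat" and sp \<tau> :: "nat \<Rightarrow> real"
    and step hue :: "bool \<Rightarrow> nat \<Rightarrow> bool"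
  assumes maxd_pos: "0 < maxd n"
    and tau_split: "\<tau> n = real (maxd n) * sp n + \<tau> (Suc n)"
    and tau_pos: "0 < \<tau> n"
    and tau_less_sp: "\<tau> (Suc n) < sp n"
    and tau_tendsto_0: "\<tau> \<longlonglongrightarrow> 0"
begin

text \<open>The real argument is the left end of an interval of the given level, the Boolean its
  flag.\<close>

inductive stage :: "nat \<Rightarrow> real \<Rightarrow> bool \<Rightarrow> bool" where
  stage_0: "stage 0 0 True"
| stage_Suc: "stage n x c \<Longrightarrow> d \<le> maxd n \<Longrightarrow> stage (Suc n) (x + real d * sp n) (step c d)"

definition gaps :: "(real \<times> real \<times> bool) set" where
  "gaps = {(x + real d * sp n + \<tau> (Suc n), x + real (Suc d) * sp n, hue c d) | n x c d.
             stage n x c \<and> d < maxd n}"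

abbreviation lower :: "real \<times> real \<times> bool \<Rightarrow> real" where "lower \<equiv> fst"
abbreviation upper :: "real \<times> real \<times> bool \<Rightarrow> real" where "upper g \<equiv> fst (snd g)"
abbreviation colour :: "real \<times> real \<times> bool \<Rightarrow> bool" where "colour g \<equiv> snd (snd g)"

definition limit_set :: "real set" where
  "limit_set = {0..\<tau> 0} - (\<Union>g\<in>gaps. {lower g <..< upper g})"

definition filled :: "real set" where
  "filled = {0..\<tau> 0} - (\<Union>g\<in>{g \<in> gaps. \<not> colour g}. {lower g <..< upper g})"

section \<open>Separation of the intervals and gaps of a scheme\<close>

lemma sp_pos: "0 < sp n"
  using tau_less_sp[of n] tau_pos[of "Suc n"] by linarith

lemma child_upper: "d \<le> maxd n \<Longrightarrow> real d * sp n + \<tau> (Suc n) \<le> \<tau> n"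
  using sp_pos[of n] mult_right_mono[of "real d" "real (maxd n)" "sp n"] tau_split[of n] by simp

lemma sp_mult_less: "d < e \<Longrightarrow> real d * sp n + \<tau> (Suc n) < real e * sp n"
  using sp_pos[of n] mult_right_mono[of "real (Suc d)" "real e" "sp n"] tau_less_sp[of n]
  by (simp add: distrib_right)

lemma stage_SucE:
  assumes "stage (Suc n) x c"
  obtains y c' d where "stage n y c'" "d \<le> maxd n" "x = y + real d * sp n" "c = step c' d"
  using assms by (auto elim: stage.cases)

text \<open>Siblings are separated because an interval is shorter than the spacing
  (\<open>tau_less_sp\<close>), other pairs because their parents are. The induction also shows that
  an interval carries only one flag.\<close>

lemma stage_disjoint:
  "stage n x c \<Longrightarrow> stage n y c' \<Longrightarrow> (x = y \<and> c = c') \<or> x + \<tau> n < y \<or> y + \<tau> n < x"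
proof (induction n arbitrary: x c y c')
  case 0
  then show ?case by (auto elim: stage.cases)
next
  case (Suc n)
  obtain x0 a d where x: "stage n x0 a" "d \<le> maxd n" "x = x0 + real d * sp n" "c = step a d"
    using Suc.prems(1) by (rule stage_SucE)
  obtain y0 b e where y: "stage n y0 b" "e \<le> maxd n" "y = y0 + real e * sp n" "c' = step b e"
    using Suc.prems(2) by (rule stage_SucE)
  have pos: "0 \<le> real d * sp n" "0 \<le> real e * sp n" using sp_pos[of n] by simp_all
  consider "x0 = y0" "a = b" | "x0 + \<tau> n < y0" | "y0 + \<tau> n < x0"
    using Suc.IH[OF x(1) y(1)] by blast
  then show ?case
  proof cases
    case 1
    consider "d = e" | "d < e" | "e < d" by linarith
    then show ?thesis
    proof cases
      case 2
      then show ?thesis using sp_mult_less[of d e n] x y 1 by simp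
    next
      case 3
      then show ?thesis using sp_mult_less[of e d n] x y 1 by simp
    qed (use x y 1 in simp)
  next
    case 2
    then show ?thesis using child_upper[OF x(2)] x(3) y(3) pos by linarith
  next
    case 3
    then show ?thesis using child_upper[OF y(2)] x(3) y(3) pos by linarith
  qed
qed

lemma stage_ancestor:
  "stage m y c \<Longrightarrow> n \<le> m \<Longrightarrow> \<exists>x a. stage n x a \<and> x \<le> y \<and> y + \<tau> m \<le> x + \<tau> n"
proof (induction rule: stage.induct)
  case stage_0
  then show ?case using stage.stage_0 by auto
next
  case (stage_Suc m x c d)
  show ?case
  proof (cases "n = Suc m")
    case True
    then show ?thesis using stage.stage_Suc[OF stage_Suc(1,2)] by blast
  next
    case False
    then obtain z a where z: "stage n z a" "z \<le> x" "x + \<tau> m \<le> z + \<tau> n"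
      using stage_Suc by auto
    moreover have "0 \<le> real d * sp m" using sp_pos[of m] by simp
    ultimately show ?thesis using child_upper[OF stage_Suc(2)] by (intro exI[of _ z] exI[of _ a]) auto
  qed
qed

lemma stage_range: "stage n x c \<Longrightarrow> 0 \<le> x \<and> x + \<tau> n \<le> \<tau> 0"
  using stage_ancestor[of n x c 0] by (auto elim: stage.cases)

lemma stage_left_end: "stage n x c \<Longrightarrow> \<exists>a. stage (n + k) x a"
proof (induction k)
  case (Suc k)
  then obtain a where "stage (n + k) x a" by blast
  from stage_Suc[OF this, of 0] show ?case by auto
qed auto

lemma gapsE:
  assumes "g \<in> gaps"
  obtains n x c d where "stage n x c" "d < maxd n" "lower g = x + real d * sp n + \<tau> (Suc n)"
    "upper g = x + real (Suc d) * sp n" "colour g = hue c d"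
  using assms unfolding gaps_def by auto

lemma gapsI:
  assumes "stage n x c" "d < maxd n"
  shows "(x + real d * sp n + \<tau> (Suc n), x + real (Suc d) * sp n, hue c d) \<in> gaps"
  using assms unfolding gaps_def by blast

lemma gap_in_stage:
  assumes "d < maxd n"
  shows "x < x + real d * sp n + \<tau> (Suc n)" "x + real (Suc d) * sp n < x + \<tau> n"
    "x + real d * sp n + \<tau> (Suc n) < x + real (Suc d) * sp n"
  using child_upper[of "Suc d" n] tau_pos[of "Suc n"] sp_mult_less[of d "Suc d" n] sp_pos[of n] assms
  by (simp_all add: add_nonneg_pos)

lemma gap_stage_disjoint:
  assumes "stage n x c" "d < maxd n" "stage (Suc n) y a"
  shows "y + \<tau> (Suc n) \<le> x + real d * sp n + \<tau> (Suc n) \<or> x + real (Suc d) * sp n \<le> y"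
proof -
  obtain z b e where y: "stage n z b" "e \<le> maxd n" "y = z + real e * sp n"
    using assms(3) by (rule stage_SucE)
  have "0 \<le> real e * sp n" using sp_pos[of n] by simp
  consider "z = x" | "x + \<tau> n < z" | "z + \<tau> n < x" using stage_disjoint[OF assms(1) y(1)] by blast
  then show ?thesis
  proof cases
    case 1
    have "real e * sp n \<le> real d * sp n \<or> real (Suc d) * sp n \<le> real e * sp n"
      using sp_pos[of n] by (cases "e \<le> d") auto
    then show ?thesis using 1 y by simp
  next
    case 2
    then show ?thesis using gap_in_stage(2)[OF assms(2), of x] y(3) \<open>0 \<le> real e * sp n\<close> by linarith
  next
    case 3
    then show ?thesis using gap_in_stage(1)[OF assms(2), of x] child_upper[OF y(2)] y(3) by linarith
  qed
qed

text \<open>The later gap lies inside an interval of level \<open>Suc n\<close>, and such intervals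
  avoid the gaps opened at level \<open>n\<close>.\<close>

lemma gap_sep_later:
  assumes "stage n x c" "d < maxd n" "stage m y a" "e < maxd m" "n < m"
  shows "x + real (Suc d) * sp n < y + real e * sp m + \<tau> (Suc m)
    \<or> y + real (Suc e) * sp m < x + real d * sp n + \<tau> (Suc n)"
proof -
  obtain z b where z: "stage (Suc n) z b" "z \<le> y" "y + \<tau> m \<le> z + \<tau> (Suc n)"
    using stage_ancestor[OF assms(3), of "Suc n"] assms(5) by auto
  show ?thesis
    using gap_stage_disjoint[OF assms(1,2) z(1)] gap_in_stage(1,2)[OF assms(4), of y] z(2,3) by linarith
qed

lemma gaps_sep:
  assumes "g \<in> gaps" "h \<in> gaps" "g \<noteq> h"
  shows "upper g < lower h \<or> upper h < lower g"
proof -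
  obtain n x c d where g: "stage n x c" "d < maxd n" "lower g = x + real d * sp n + \<tau> (Suc n)"
    "upper g = x + real (Suc d) * sp n" "colour g = hue c d" using assms(1) by (rule gapsE)
  obtain m y a e where h: "stage m y a" "e < maxd m" "lower h = y + real e * sp m + \<tau> (Suc m)"
    "upper h = y + real (Suc e) * sp m" "colour h = hue a e" using assms(2) by (rule gapsE)
  consider "n < m" | "m < n" | "n = m" by linarith
  then show ?thesis
  proof cases
    case 1
    then show ?thesis using gap_sep_later[OF g(1,2) h(1,2)] g h by simp
  next
    case 2
    then show ?thesis using gap_sep_later[OF h(1,2) g(1,2)] g h by auto
  next
    case 3
    consider "x = y" "c = a" | "x + \<tau> n < y" | "y + \<tau> n < x"
      using stage_disjoint[OF g(1)] h(1) 3 by blast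
    then show ?thesis
    proof cases
      case 1
      have "d \<noteq> e"
      proof
        assume "d = e"
        then have "g = h" using g h 1 3 by (simp add: prod_eq_iff)
        with assms(3) show False by simp
      qed
      then consider "Suc d \<le> e" | "Suc e \<le> d" by linarith
      then show ?thesis
      proof cases
        case a: 1
        then have "real (Suc d) * sp n \<le> real e * sp n" using sp_pos[of n] by (intro mult_right_mono) auto
        then show ?thesis using g h 1 3 tau_pos[of "Suc n"] by simp
      next
        case b: 2
        then have "real (Suc e) * sp n \<le> real d * sp n" using sp_pos[of n] by (intro mult_right_mono) auto
        then show ?thesis using g h 1 3 tau_pos[of "Suc n"] by simp
      qed
    next
      case 2
      then show ?thesis
        using g h 3 gap_in_stage(2)[OF g(2), of x] gap_in_stage(1)[OF h(2), of y] by simp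
    next
      case b: 3
      then show ?thesis
        using g h 3 gap_in_stage(1)[OF g(2), of x] gap_in_stage(2)[OF h(2), of y] by simp
    qed
  qed
qed

lemma gaps_inside:
  assumes "g \<in> gaps"
  shows "0 < lower g" "lower g < upper g" "upper g < \<tau> 0"
proof -
  obtain n x c d where g: "stage n x c" "d < maxd n" "lower g = x + real d * sp n + \<tau> (Suc n)"
    "upper g = x + real (Suc d) * sp n" "colour g = hue c d" using assms by (rule gapsE)
  show "0 < lower g" "lower g < upper g" "upper g < \<tau> 0"
    using stage_range[OF g(1)] gap_in_stage[OF g(2), of x] g(3,4) by linarith+
qed

text \<open>The count later bounds the number of covering intervals in the upper bound for the
  dimension.\<close>

lemma finite_stage: "finite {p. stage n (fst p) (snd p)}"
  and card_stage: "card {p. stage n (fst p) (snd p)} \<le> (\<Prod>i<n. Suc (maxd i))"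
proof -
  have "finite {p. stage n (fst p) (snd p)} \<and> card {p. stage n (fst p) (snd p)} \<le> (\<Prod>i<n. Suc (maxd i))"
  proof (induction n)
    case 0
    have "{p. stage 0 (fst p) (snd p)} = {(0, True)}"
      by (auto intro: stage_0 elim: stage.cases)
    then show ?case by simp
  next
    case (Suc n)
    let ?S = "{p. stage n (fst p) (snd p)} \<times> {..maxd n}"
    let ?f = "\<lambda>(p, d). (fst p + real d * sp n, step (snd p) d)"
    have sub: "{p. stage (Suc n) (fst p) (snd p)} \<subseteq> ?f ` ?S"
    proof
      fix q assume "q \<in> {p. stage (Suc n) (fst p) (snd p)}"
      then obtain y c d where "stage n y c" "d \<le> maxd n" "fst q = y + real d * sp n" "snd q = step c d"
        by (auto elim: stage_SucE)
      then show "q \<in> ?f ` ?S"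
        by (intro image_eqI[of _ _ "((y, c), d)"]) (auto simp: prod_eq_iff)
    qed
    have fin: "finite ?S" using Suc by simp
    have "card {p. stage (Suc n) (fst p) (snd p)} \<le> card ?S"
      using card_mono[OF _ sub] card_image_le[OF fin, of ?f] fin by (meson finite_imageI le_trans)
    also have "\<dots> \<le> (\<Prod>i<n. Suc (maxd i)) * Suc (maxd n)"
      using Suc by (simp add: card_cartesian_product del: mult_Suc_right)
    finally show ?case using finite_subset[OF sub] fin by (simp del: mult_Suc_right)
  qed
  then show "finite {p. stage n (fst p) (snd p)}"
    "card {p. stage n (fst p) (snd p)} \<le> (\<Prod>i<n. Suc (maxd i))" by auto
qed

lemma countable_gap_set: "countable gaps"
proof -
  have "gaps \<subseteq> (\<Union>n. \<Union>p\<in>{p. stage n (fst p) (snd p)}.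
      (\<lambda>d. (fst p + real d * sp n + \<tau> (Suc n), fst p + real (Suc d) * sp n, hue (snd p) d)) ` UNIV)"
    unfolding gaps_def by force
  moreover have "countable \<dots>"
    using countable_finite[OF finite_stage] by (intro countable_UN countable_image) auto
  ultimately show ?thesis by (rule countable_subset)
qed

text \<open>Descend to the last subinterval that begins at or before \<open>x\<close>. If
  \<open>x\<close> lies beyond its end, then \<open>x\<close> is in the gap that follows, since the
  last subinterval ends together with its parent.\<close>

lemma stage_or_gap:
  assumes "0 \<le> x" "x \<le> \<tau> 0"
  shows "(\<exists>y c. stage n y c \<and> y \<le> x \<and> x \<le> y + \<tau> n) \<or> (\<exists>g\<in>gaps. lower g < x \<and> x < upper g)"
proof (induction n)
  case 0
  then show ?case using assms stage_0 by auto
next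
  case (Suc n)
  show ?case
  proof (cases "\<exists>g\<in>gaps. lower g < x \<and> x < upper g")
    case False
    then obtain y c where y: "stage n y c" "y \<le> x" "x \<le> y + \<tau> n" using Suc by blast
    define D where "D = {d. d \<le> maxd n \<and> y + real d * sp n \<le> x}"
    have fin: "finite D" unfolding D_def by simp
    have "0 \<in> D" using y by (simp add: D_def)
    define d where "d = Max D"
    have d: "d \<in> D" unfolding d_def using fin \<open>0 \<in> D\<close> by (intro Max_in) auto
    have next_d: "Suc d \<notin> D" using Max_ge[OF fin, of "Suc d"] by (auto simp: d_def)
    have "x \<le> y + real d * sp n + \<tau> (Suc n)"
    proof (rule ccontr)
      assume *: "\<not> ?thesis"
      show False
      proof (cases "d < maxd n")
        case True
        then have "x < y + real (Suc d) * sp n" using next_d by (auto simp: D_def)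
        with False * gapsI[OF y(1) True] show False by fastforce
      next
        case f: False
        then have "d = maxd n" using d by (simp add: D_def)
        then show False using * y(3) tau_split[of n] by simp
      qed
    qed
    then show ?thesis using stage_Suc[OF y(1), of d] d by (auto simp: D_def)
  qed blast
qed

text \<open>Identifies what is left after removing all gaps with the intersection of the
  levels.\<close>

lemma limit_set_iff:
  "x \<in> limit_set \<longleftrightarrow> (\<forall>n. \<exists>y c. stage n y c \<and> y \<le> x \<and> x \<le> y + \<tau> n)"
proof (intro iffI)
  assume "x \<in> limit_set"
  then show "\<forall>n. \<exists>y c. stage n y c \<and> y \<le> x \<and> x \<le> y + \<tau> n"
    using stage_or_gap[of x] unfolding limit_set_def by fastforce
next
  assume all: "\<forall>n. \<exists>y c. stage n y c \<and> y \<le> x \<and> x \<le> y + \<tau> n"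
  then obtain y c where "stage 0 y c" "y \<le> x" "x \<le> y + \<tau> 0" by blast
  then have range: "0 \<le> x" "x \<le> \<tau> 0" using stage_range[of 0 y c] by auto
  have "\<not> (lower g < x \<and> x < upper g)" if in_gaps: "g \<in> gaps" for g
  proof -
    obtain n z a d where g: "stage n z a" "d < maxd n" "lower g = z + real d * sp n + \<tau> (Suc n)"
      "upper g = z + real (Suc d) * sp n" "colour g = hue a d" using in_gaps by (rule gapsE)
    obtain w b where "stage (Suc n) w b" "w \<le> x" "x \<le> w + \<tau> (Suc n)" using all by blast
    then show ?thesis using gap_stage_disjoint[OF g(1,2), of w b] g by linarith
  qed
  with range show "x \<in> limit_set" unfolding limit_set_def by force
qed

lemma filled_eq:
  "filled = limit_set \<union> (\<Union>g\<in>{g \<in> gaps. colour g}. {lower g <..< upper g})"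
proof -
  have "x \<in> {0..\<tau> 0}" if "g \<in> gaps" "x \<in> {lower g <..< upper g}" for x g
    using gaps_inside[OF that(1)] that(2) by auto
  moreover have "g = h" if "g \<in> gaps" "h \<in> gaps" "x \<in> {lower g <..< upper g}" "x \<in> {lower h <..< upper h}" for x g h
    using gaps_sep[OF that(1,2)] that(3,4) by fastforce
  ultimately show ?thesis unfolding filled_def limit_set_def by blast
qed

lemma tau_small: "0 < e \<Longrightarrow> \<exists>n\<ge>k. \<tau> n < e"
  using order_tendstoD(2)[OF tau_tendsto_0, of e] unfolding eventually_sequentially by (meson le_cases)

end

section \<open>Schemes in which both colours accumulate at every point of the limit set\<close>

locale two_coloured_scheme = cantor_scheme +
  assumes both_colours: "stage n x c \<Longrightarrow> \<exists>g\<in>gaps. colour g = b \<and> x < lower g \<and> upper g < x + \<tau> n"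
begin

lemma colour_near:
  assumes "x \<in> limit_set" "0 < e"
  shows "\<exists>g\<in>gaps. colour g = b \<and> x - e < lower g \<and> upper g < x + e"
proof -
  obtain n where "\<tau> n < e" using tau_small[OF assms(2), of 0] by blast
  obtain y c where y: "stage n y c" "y \<le> x" "x \<le> y + \<tau> n" using assms(1) limit_set_iff by blast
  obtain g where "g \<in> gaps" "colour g = b" "y < lower g" "upper g < y + \<tau> n"
    using both_colours[OF y(1)] by blast
  with y \<open>\<tau> n < e\<close> show ?thesis by (intro bexI[of _ g]) auto
qed

sublocale coloured_gaps gaps lower "\<lambda>g. upper g" "\<lambda>g. colour g" 0 "\<tau> 0"
proof
  fix g h x y c
  show "countable gaps" by (rule countable_gap_set)
  show "lower g < upper g" if "g \<in> gaps" using gaps_inside[OF that] by simp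
  show "0 < lower g \<and> upper g < \<tau> 0" if "g \<in> gaps" using gaps_inside[OF that] by simp
  show "upper g < lower h \<or> upper h < lower g" if "g \<in> gaps" "h \<in> gaps" "g \<noteq> h"
    using that by (rule gaps_sep)
  show "0 < \<tau> 0" by (rule tau_pos)
  show "\<exists>g\<in>gaps. colour g = c \<and> x < lower g \<and> upper g < y"
    if x: "x \<in> insert 0 ((\<lambda>g. upper g) ` gaps)" and "x < y"
  proof -
    \<comment> \<open>\<open>x\<close> is the left end of an interval of some level, hence of
      arbitrarily short ones, and each of these contains gaps of both colours.\<close>
    have "\<exists>n a. stage n x a"
    proof (cases "x = 0")
      case True
      then show ?thesis using stage_0 by blast
    next
      case False
      then obtain g where "g \<in> gaps" "x = upper g" using x by blast
      then obtain n z a d where "stage n z a" "d < maxd n" "x = z + real (Suc d) * sp n"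
        by (auto elim: gapsE)
      then show ?thesis using stage_Suc[of n z a "Suc d"] by auto
    qed
    then obtain n a where "stage n x a" by blast
    obtain m where m: "m \<ge> n" "\<tau> m < y - x" using tau_small[of "y - x" n] \<open>x < y\<close> by auto
    then obtain a' where "stage m x a'"
      using stage_left_end[OF \<open>stage n x a\<close>, of "m - n"] by auto
    from both_colours[OF this, of c] m show ?thesis by fastforce
  qed
  show "\<exists>g\<in>gaps. lower g < y \<and> x < upper g" if xy: "0 \<le> x" "x < y" "y \<le> \<tau> 0"
  proof (cases "(x + y) / 2 \<in> limit_set")
    case True
    have "0 < (y - x) / 2" using xy by simp
    from colour_near[OF True this] obtain g
      where g: "g \<in> gaps" "(x + y) / 2 - (y - x) / 2 < lower g" "upper g < (x + y) / 2 + (y - x) / 2"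
      by blast
    have "x < lower g" "upper g < y" using g(2,3) by (simp_all add: field_simps)
    then show ?thesis using gaps_inside(2)[OF g(1)] g(1) by (intro bexI[of _ g]) auto
  next
    case False
    then obtain g where "g \<in> gaps" "lower g < (x + y) / 2" "(x + y) / 2 < upper g"
      using xy unfolding limit_set_def by auto
    then show ?thesis using xy by (intro bexI[of _ g]) auto
  qed
qed

lemma filled_eq_retained: "filled = retained"
  unfolding filled_def retained_def ..

text \<open>A filled gap is open, so its points are interior; at a point of the limit set the
  unfilled gaps accumulate.\<close>

lemma filled_minus_interior: "filled - interior filled = limit_set"
proof (intro equalityI subsetI)
  fix x assume x: "x \<in> filled - interior filled"
  show "x \<in> limit_set"
  proof (rule ccontr)
    assume "x \<notin> limit_set"
    then obtain g where g: "g \<in> gaps" "colour g" "x \<in> {lower g <..< upper g}"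
      using x filled_eq by auto
    then have "{lower g <..< upper g} \<subseteq> filled" using filled_eq by blast
    then have "x \<in> interior filled" using g by (intro interiorI[of "{lower g <..< upper g}"]) auto
    with x show False by blast
  qed
next
  fix x assume x: "x \<in> limit_set"
  have "x \<notin> interior filled"
  proof
    assume "x \<in> interior filled"
    then obtain e where e: "0 < e" "ball x e \<subseteq> filled" using mem_interior by blast
    obtain g where g: "g \<in> gaps" "\<not> colour g" "x - e < lower g" "upper g < x + e"
      using colour_near[OF x e(1), of False] by auto
    obtain u where u: "lower g < u" "u < upper g" using dense gaps_inside(2)[OF g(1)] by blast
    then have "u \<in> filled" using e g by (auto simp: subset_eq dist_real_def)
    then show False using g(1,2) u unfolding filled_def by fastforce
  qed
  then show "x \<in> filled - interior filled" using x filled_eq by blast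
qed

end

theorem filled_homeomorphic:
  assumes "two_coloured_scheme maxd sp \<tau> step hue" "two_coloured_scheme maxd' sp' \<tau>' step' hue'"
  shows "cantor_scheme.filled maxd sp \<tau> step hue homeomorphic cantor_scheme.filled maxd' sp' \<tau>' step' hue'"
proof -
  interpret A: two_coloured_scheme maxd sp \<tau> step hue by fact
  interpret B: two_coloured_scheme maxd' sp' \<tau>' step' hue' by fact
  show ?thesis
    unfolding A.filled_eq_retained B.filled_eq_retained
    by (rule retained_homeomorphic[OF A.coloured_gaps_axioms B.coloured_gaps_axioms])
qed

section \<open>The ternary model\<close>

definition ternary_maxd :: "nat \<Rightarrow> nat" where
  "ternary_maxd n = 1"

definition ternary_sp :: "nat \<Rightarrow> real" where
  "ternary_sp n = 2 / 3 ^ Suc n"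

definition ternary_tau :: "nat \<Rightarrow> real" where
  "ternary_tau n = 1 / 3 ^ n"

text \<open>The flag flips at every level and is itself the colour, so the filled gaps are those
  opened inside intervals of even level. Steps being numbered from 1, these are the gaps of the odd
  steps.\<close>

interpretation ternary: two_coloured_scheme ternary_maxd ternary_sp ternary_tau "\<lambda>c d. \<not> c" "\<lambda>c d. c"
proof -
  interpret cantor_scheme ternary_maxd ternary_sp ternary_tau "\<lambda>c d. \<not> c" "\<lambda>c d. c"
  proof
    fix n
    show "0 < ternary_maxd n" by (simp add: ternary_maxd_def)
    show "ternary_tau n = real (ternary_maxd n) * ternary_sp n + ternary_tau (Suc n)"
      by (simp add: ternary_maxd_def ternary_sp_def ternary_tau_def)
    show "0 < ternary_tau n" by (simp add: ternary_tau_def)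
    show "ternary_tau (Suc n) < ternary_sp n"
      by (simp add: ternary_sp_def ternary_tau_def divide_strict_right_mono)
    show "ternary_tau \<longlonglongrightarrow> 0"
      using LIMSEQ_realpow_zero[of "1 / 3 :: real"] by (simp add: power_divide ternary_tau_def[abs_def])
  qed
  show "two_coloured_scheme ternary_maxd ternary_sp ternary_tau (\<lambda>c d. \<not> c) (\<lambda>c d. c)"
  proof
    fix n x c b
    assume st: "stage n x c"
    have own: "\<exists>g\<in>gaps. colour g = a \<and> y < lower g \<and> upper g < y + ternary_tau m"
      if "stage m y a" for m y a
    proof -
      have "0 < ternary_maxd m" by (simp add: ternary_maxd_def)
      with gap_in_stage(1,2)[of 0 m y] show ?thesis
        by (intro bexI[OF _ gapsI[OF that]]) (simp_all only: fst_conv snd_conv)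
    qed
    show "\<exists>g\<in>gaps. colour g = b \<and> x < lower g \<and> upper g < x + ternary_tau n"
    proof (cases "b = c")
      case True
      show ?thesis unfolding True by (rule own[OF st])
    next
      case False
      \<comment> \<open>The leftmost subinterval has the opposite flag and supplies the missing
        colour.\<close>
      have "stage (Suc n) x (\<not> c)" using stage_Suc[OF st, of 0] by simp
      from own[OF this] obtain g
        where g: "g \<in> gaps" "colour g = (\<not> c)" "x < lower g" "upper g < x + ternary_tau (Suc n)"
        by blast
      have "ternary_tau (Suc n) \<le> ternary_tau n" using child_upper[of 0 n] by simp
      then have "upper g < x + ternary_tau n" using g(4) by linarith
      moreover have "colour g = b" using False g(2) by blast
      ultimately show ?thesis using g(1,3) by blast
    qed
  qed
qed

lemma ternary_stage_colour: "ternary.stage n x c \<Longrightarrow> c = even n"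
  by (induction rule: ternary.stage.induct) auto

lemma cantor_stage_eq:
  "cantor_stage n = {(x, x + 1 / 3 ^ n) | x. ternary.stage n x (even n)}"
proof (induction n)
  case 0
  have "ternary.stage 0 x True \<longleftrightarrow> x = 0" for x
    using ternary.stage_0 by (auto elim: ternary.stage.cases)
  then show ?case by simp
next
  case (Suc n)
  have "ternary.stage (Suc n) x (even (Suc n)) \<longleftrightarrow>
      (\<exists>y. ternary.stage n y (even n) \<and> (x = y \<or> x = y + 2 / 3 ^ Suc n))" for x
  proof
    assume "ternary.stage (Suc n) x (even (Suc n))"
    then obtain y c d where "ternary.stage n y c" "d \<le> ternary_maxd n" "x = y + real d * ternary_sp n"
      by (rule ternary.stage_SucE)
    moreover have "d = 0 \<or> d = 1" using \<open>d \<le> ternary_maxd n\<close> by (auto simp: ternary_maxd_def)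
    ultimately show "\<exists>y. ternary.stage n y (even n) \<and> (x = y \<or> x = y + 2 / 3 ^ Suc n)"
      using ternary_stage_colour[of n y c] by (auto simp: ternary_sp_def)
  next
    assume "\<exists>y. ternary.stage n y (even n) \<and> (x = y \<or> x = y + 2 / 3 ^ Suc n)"
    then obtain y where y: "ternary.stage n y (even n)" and "x = y \<or> x = y + 2 / 3 ^ Suc n" by blast
    then show "ternary.stage (Suc n) x (even (Suc n))"
      using ternary.stage_Suc[OF y, of 0] ternary.stage_Suc[OF y, of 1]
      by (auto simp: ternary_maxd_def ternary_sp_def)
  qed
  then have stage_eq: "{(x, x + 1 / 3 ^ Suc n) | x. ternary.stage (Suc n) x (even (Suc n))} =
      (\<Union>y\<in>{y. ternary.stage n y (even n)}.
         {(y, y + 1 / 3 ^ Suc n), (y + 2 / 3 ^ Suc n, y + 2 / 3 ^ Suc n + 1 / 3 ^ Suc n)})"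
    by blast
  have split: "(\<Union>(a, b)\<in>{(x, h x) | x. P x}. F a b) = (\<Union>y\<in>{y. P y}. F y (h y))"
    for P :: "real \<Rightarrow> bool" and h and F :: "real \<Rightarrow> real \<Rightarrow> (real \<times> real) set"
    by auto
  have "{(y, y + (y + 1 / 3 ^ n - y) / 3), (y + 1 / 3 ^ n - (y + 1 / 3 ^ n - y) / 3, y + 1 / 3 ^ n)} =
      {(y, y + 1 / 3 ^ Suc n), (y + 2 / 3 ^ Suc n, y + 2 / 3 ^ Suc n + 1 / 3 ^ Suc n)}" for y :: real
  proof -
    have e1: "y + (y + 1 / 3 ^ n - y) / 3 = y + 1 / 3 ^ Suc n" by simp
    have e2: "y + 1 / 3 ^ n = y + 2 / 3 ^ Suc n + 1 / 3 ^ Suc n" by simp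
    have e3: "y + 1 / 3 ^ n - (y + 1 / 3 ^ n - y) / 3 = y + 2 / 3 ^ Suc n" by simp
    show ?thesis unfolding e1 e3 unfolding e2 ..
  qed
  then show ?case unfolding cantor_stage.simps Suc.IH split stage_eq by simp
qed

lemma cantor_ternary_eq: "cantor_ternary = ternary.limit_set"
proof (rule set_eqI)
  fix x
  have "x \<in> cantor_ternary \<longleftrightarrow> (\<forall>n. \<exists>y. ternary.stage n y (even n) \<and> y \<le> x \<and> x \<le> y + 1 / 3 ^ n)"
    unfolding cantor_ternary_def cantor_stage_eq by auto
  also have "\<dots> \<longleftrightarrow> x \<in> ternary.limit_set"
    unfolding ternary.limit_set_iff ternary_tau_def using ternary_stage_colour by blast
  finally show "x \<in> cantor_ternary \<longleftrightarrow> x \<in> ternary.limit_set" .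
qed

lemma cantor_gap_eq:
  "cantor_gap (Suc n) = (\<Union>x\<in>{x. ternary.stage n x (even n)}. {x + 1 / 3 ^ Suc n <..< x + 2 / 3 ^ Suc n})"
proof -
  have "x + (x + 1 / 3 ^ n - x) / 3 = x + 1 / 3 ^ Suc n"
    "x + 1 / 3 ^ n - (x + 1 / 3 ^ n - x) / 3 = x + 2 / 3 ^ Suc n" for x :: real
    by (simp_all add: field_simps)
  then show ?thesis unfolding cantor_gap_def cantor_stage_eq by (auto simp del: power_Suc)
qed

lemma odd_cantor_gaps_eq:
  "(\<Union>n\<in>{1..}. cantor_gap (2 * n - 1)) =
     (\<Union>g\<in>{g \<in> ternary.gaps. ternary.colour g}. {ternary.lower g <..< ternary.upper g})" (is "?A = ?B")
proof (intro equalityI subsetI)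
  fix u assume "u \<in> ?A"
  then obtain n where n: "1 \<le> n" "u \<in> cantor_gap (2 * n - 1)" by auto
  \<comment> \<open>Step \<open>2 * n - 1\<close> acts on the intervals of level
    \<open>2 * n - 2\<close>, which is even.\<close>
  define m where "m = 2 * n - 2"
  have m: "2 * n - 1 = Suc m" "even m" using n(1) by (auto simp: m_def)
  then obtain x where x: "ternary.stage m x True" "u \<in> {x + 1 / 3 ^ Suc m <..< x + 2 / 3 ^ Suc m}"
    using n(2) cantor_gap_eq[of m] by auto
  have "(x + 1 / 3 ^ Suc m, x + 2 / 3 ^ Suc m, True) \<in> ternary.gaps"
    using ternary.gapsI[OF x(1), of 0] by (simp add: ternary_maxd_def ternary_sp_def ternary_tau_def)
  then show "u \<in> ?B" using x(2) by force
next
  fix u assume "u \<in> ?B"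
  then obtain g where g: "g \<in> ternary.gaps" "ternary.colour g" "u \<in> {ternary.lower g <..< ternary.upper g}"
    by blast
  from g(1) obtain m x c d where x: "ternary.stage m x c" "d < ternary_maxd m"
    "ternary.lower g = x + real d * ternary_sp m + ternary_tau (Suc m)"
    "ternary.upper g = x + real (Suc d) * ternary_sp m" "ternary.colour g = c"
    by (rule ternary.gapsE)
  have "even m" using ternary_stage_colour[OF x(1)] x(5) g(2) by simp
  have "u \<in> cantor_gap (Suc m)"
    unfolding cantor_gap_eq using g x ternary_stage_colour[OF x(1)]
    by (auto simp: ternary_maxd_def ternary_sp_def ternary_tau_def simp del: power_Suc)
  moreover have "Suc m = 2 * Suc (m div 2) - 1" using \<open>even m\<close> by auto
  ultimately have "u \<in> cantor_gap (2 * Suc (m div 2) - 1)" by metis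
  then show "u \<in> ?A" by (rule UN_I[rotated]) simp
qed

lemma is_cantorval_filled:
  assumes "two_coloured_scheme maxd sp \<tau> step hue"
  shows "is_cantorval (cantor_scheme.filled maxd sp \<tau> step hue)"
  unfolding is_cantorval_def cantor_ternary_eq odd_cantor_gaps_eq ternary.filled_eq[symmetric]
  by (rule filled_homeomorphic[OF assms ternary.two_coloured_scheme_axioms])

section \<open>Digit expansions and tiling\<close>

definition expansion :: "real \<Rightarrow> (nat \<Rightarrow> nat) \<Rightarrow> real" where
  "expansion b \<delta> = (\<Sum>i. real (\<delta> i) / b ^ Suc i)"

context
  fixes b :: real and m :: nat
  assumes b: "1 < b"
begin

lemma digit_sums: "(\<lambda>i. real m / b ^ Suc i) sums (real m / (b - 1))"
proof -
  have "(\<lambda>i. (1 / b) ^ i) sums (1 / (1 - 1 / b))"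
    using b by (intro geometric_sums) simp
  from sums_mult[OF this, of "real m / b"] show ?thesis
    using b by (simp add: power_divide field_simps)
qed

context
  fixes \<delta> :: "nat \<Rightarrow> nat"
  assumes digits: "\<And>i. \<delta> i \<le> m"
begin

lemma expansion_term_le: "real (\<delta> i) / b ^ Suc i \<le> real m / b ^ Suc i"
  using b digits[of i] by (intro divide_right_mono) auto

lemma expansion_summable: "summable (\<lambda>i. real (\<delta> i) / b ^ Suc i)"
proof (rule summable_comparison_test'[OF sums_summable[OF digit_sums]])
  show "norm (real (\<delta> n) / b ^ Suc n) \<le> real m / b ^ Suc n" for n
    using expansion_term_le[of n] b by simp
qed

lemma expansion_nonneg: "0 \<le> expansion b \<delta>"
  unfolding expansion_def using b by (intro suminf_nonneg expansion_summable) auto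

lemma expansion_le: "expansion b \<delta> \<le> real m / (b - 1)"
  unfolding expansion_def sums_unique[OF digit_sums]
  by (intro suminf_le expansion_term_le expansion_summable sums_summable[OF digit_sums])

lemma expansion_split:
  "expansion b \<delta> = (\<Sum>i<n. real (\<delta> i) / b ^ Suc i) + expansion b (\<lambda>i. \<delta> (i + n)) / b ^ n"
proof -
  have "summable (\<lambda>i. real (\<delta> (i + n)) / b ^ Suc (i + n))"
    using summable_ignore_initial_segment[OF expansion_summable, of n] .
  then have "(\<Sum>i. real (\<delta> (i + n)) / b ^ Suc (i + n)) * b ^ n = (\<Sum>i. real (\<delta> (i + n)) / b ^ Suc (i + n) * b ^ n)"
    by (rule suminf_mult2)
  also have "\<dots> = expansion b (\<lambda>i. \<delta> (i + n))"
    unfolding expansion_def using b by (simp add: power_add)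
  finally have "(\<Sum>i. real (\<delta> (i + n)) / b ^ Suc (i + n)) = expansion b (\<lambda>i. \<delta> (i + n)) / b ^ n"
    using b by (simp add: field_simps)
  then show ?thesis
    unfolding expansion_def[of b \<delta>] using suminf_split_initial_segment[OF expansion_summable, of n]
    by simp
qed

end

text \<open>A membership criterion: if a digit can always be stripped without leaving
  \<open>Y\<close>, the remainder after \<open>n\<close> digits is \<open>z n / b ^ n\<close>, which
  tends to 0 because \<open>Y\<close> is bounded.\<close>

lemma expansion_exists:
  assumes inv: "\<And>y. y \<in> Y \<Longrightarrow> \<exists>t\<in>D. b * y - real t \<in> Y"
    and bound: "\<And>y. y \<in> Y \<Longrightarrow> \<bar>y\<bar> \<le> B" and "y \<in> Y"
  shows "\<exists>\<delta>. (\<forall>i. \<delta> i \<in> D) \<and> y = expansion b \<delta>"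
proof -
  obtain t where t: "\<And>y. y \<in> Y \<Longrightarrow> t y \<in> D \<and> b * y - real (t y) \<in> Y"
    using inv by metis
  define z where "z n = ((\<lambda>y. b * y - real (t y)) ^^ n) y" for n
  have z: "z 0 = y" "z (Suc n) = b * z n - real (t (z n))" for n by (simp_all add: z_def)
  have zY: "z n \<in> Y" for n by (induction n) (simp_all add: z \<open>y \<in> Y\<close> t)
  have partial: "(\<Sum>i<n. real (t (z i)) / b ^ Suc i) = y - z n / b ^ n" for n
  proof (induction n)
    case (Suc n)
    have "z n / b ^ n = real (t (z n)) / b ^ Suc n + z (Suc n) / b ^ Suc n"
      using b by (simp add: z(2) field_simps)
    with Suc show ?case by simp
  qed (simp add: z)
  have "(\<lambda>n. B * (1 / b) ^ n) \<longlonglongrightarrow> B * 0"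
    using b by (intro tendsto_intros LIMSEQ_realpow_zero) auto
  then have B0: "(\<lambda>n. B * (1 / b) ^ n) \<longlonglongrightarrow> 0" by simp
  have "norm (z n / b ^ n) \<le> B * (1 / b) ^ n" for n
  proof -
    have "\<bar>z n\<bar> / b ^ n \<le> B / b ^ n"
      using bound[OF zY, of n] b by (intro divide_right_mono) simp_all
    then show ?thesis using b by (simp add: abs_divide power_divide)
  qed
  then have "(\<lambda>n. z n / b ^ n) \<longlonglongrightarrow> 0"
    by (rule Lim_null_comparison[OF eventuallyI B0])
  from tendsto_diff[OF tendsto_const this, of y]
  have "(\<lambda>i. real (t (z i)) / b ^ Suc i) sums y"
    unfolding sums_def partial by (simp only: diff_zero)
  then have "y = expansion b (\<lambda>i. t (z i))" unfolding expansion_def by (rule sums_unique)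
  then show ?thesis using t[OF zY] by (intro exI[of _ "\<lambda>i. t (z i)"]) simp
qed

end

section \<open>The digit set and the tiling of the line by translates of \<open>K l\<close>\<close>

lemma T_iff: "t \<in> T l \<longleftrightarrow> (if even t then t \<le> 2 * l else 2 * l + 1 \<le> t \<and> t \<le> 4 * l + 1)"
  unfolding T_def by auto

lemma T_residues:
  fixes N :: int
  shows "\<exists>t\<in>T l. \<exists>q. N = int t + int (2 * l + 2) * q"
proof -
  define r where "r = nat (N mod int (2 * l + 2))"
  have N: "N = int r + int (2 * l + 2) * (N div int (2 * l + 2))"
    unfolding r_def by (simp add: pos_mod_sign)
  have r: "r < 2 * l + 2" unfolding r_def by (simp add: nat_less_iff)
  show ?thesis
  \<comment> \<open>Even residues and \<open>2 * l + 1\<close> are digits themselves; the smaller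
    odd residues become digits after adding the modulus once.\<close>
  proof (cases "even r \<or> r = 2 * l + 1")
    case True
    then have "r \<in> T l" using r unfolding T_iff by presburger
    with N show ?thesis by blast
  next
    case False
    then have "r + (2 * l + 2) \<in> T l" using r unfolding T_iff by presburger
    moreover have "N = int (r + (2 * l + 2)) + int (2 * l + 2) * (N div int (2 * l + 2) - 1)"
      using N by (simp add: algebra_simps)
    ultimately show ?thesis by blast
  qed
qed

locale guthrie_nymann =
  fixes l :: nat
  assumes l_pos: "1 \<le> l"
begin

definition b :: real where "b = real (2 * l + 2)"
text \<open>The largest number with base \<open>b\<close> digits at most \<open>2 * l\<close>, so
  the length of the hull of the Cantor set of such numbers.\<close>

definition H :: real where "H = real (2 * l) / real (2 * l + 1)"

lemma b_gt_1: "1 < b"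
  using l_pos by (simp add: b_def)

lemma H_pos: "0 < H" and H_less_1: "H < 1" and b_H: "b * H = real (2 * l) + H"
  using l_pos by (auto simp: b_def H_def field_simps)

lemma K_eq: "K l = {expansion b \<epsilon> | \<epsilon>. \<forall>i. \<epsilon> i \<in> T l}"
  unfolding K_def expansion_def b_def ..

lemma T_le: "t \<in> T l \<Longrightarrow> t \<le> 4 * l + 1"
  by (auto simp: T_iff split: if_splits)

lemma K_bounds: "x \<in> K l \<Longrightarrow> 0 \<le> x \<and> x \<le> 1 + H"
proof -
  assume "x \<in> K l"
  then obtain \<epsilon> where e: "x = expansion b \<epsilon>" "\<And>i. \<epsilon> i \<le> 4 * l + 1" using K_eq T_le by auto
  have "real (4 * l + 1) / (b - 1) = 1 + H" by (simp add: b_def H_def field_simps)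
  then show ?thesis
    using expansion_nonneg[OF b_gt_1 e(2)] expansion_le[OF b_gt_1 e(2)] e(1) by simp
qed

lemma K_I:
  assumes "\<And>y. y \<in> Y \<Longrightarrow> \<exists>t\<in>T l. b * y - real t \<in> Y" "\<And>y. y \<in> Y \<Longrightarrow> \<bar>y\<bar> \<le> B" "y \<in> Y"
  shows "y \<in> K l"
  using expansion_exists[OF b_gt_1 assms] by (auto simp: K_eq)

lemma K_step: "x \<in> K l \<longleftrightarrow> (\<exists>t\<in>T l. b * x - real t \<in> K l)"
proof
  assume "x \<in> K l"
  then obtain \<epsilon> where e: "x = expansion b \<epsilon>" "\<And>i. \<epsilon> i \<in> T l" using K_eq by auto
  then have "x = real (\<epsilon> 0) / b + expansion b (\<lambda>i. \<epsilon> (Suc i)) / b"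
    using expansion_split[OF b_gt_1, of \<epsilon> "4 * l + 1" 1] T_le by simp
  then have "b * x - real (\<epsilon> 0) = expansion b (\<lambda>i. \<epsilon> (Suc i))"
    using b_gt_1 by (simp add: field_simps)
  then have "b * x - real (\<epsilon> 0) \<in> K l" using e(2) K_eq by auto
  then show "\<exists>t\<in>T l. b * x - real t \<in> K l" using e(2) by blast
next
  assume *: "\<exists>t\<in>T l. b * x - real t \<in> K l"
  then obtain t \<epsilon> where t: "t \<in> T l" "b * x - real t = expansion b \<epsilon>" "\<And>i. \<epsilon> i \<in> T l"
    using K_eq by auto
  define \<delta> where "\<delta> i = (case i of 0 \<Rightarrow> t | Suc j \<Rightarrow> \<epsilon> j)" for i
  have d: "\<delta> i \<in> T l" for i using t by (simp add: \<delta>_def split: nat.split)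
  have "expansion b \<delta> = real (\<delta> 0) / b + expansion b (\<lambda>i. \<delta> (Suc i)) / b"
    using expansion_split[OF b_gt_1, of \<delta> "4 * l + 1" 1] T_le d by simp
  also have "\<dots> = x" using t(2) b_gt_1 by (simp add: \<delta>_def field_simps)
  finally show "x \<in> K l" using d K_eq by auto
qed

lemma zero_in_K: "0 \<in> K l"
  by (rule K_I[of "{0}" 0]) (auto intro!: bexI[of _ 0] simp: T_iff)

text \<open>The closure of \<open>K l\<close> satisfies the same self-similarity, so its points have digit expansions too.\<close>

lemma closed_K: "closed (K l)"
proof -
  have fin: "finite (T l)" using T_le by (auto intro: finite_subset[of _ "{..4 * l + 1}"])
  define f where "f t x = (x + real t) / b" for t x
  have "closure (K l) \<subseteq> (\<Union>t\<in>T l. f t ` closure (K l))"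
  proof (rule closure_minimal)
    show "K l \<subseteq> (\<Union>t\<in>T l. f t ` closure (K l))"
    proof
      fix x assume "x \<in> K l"
      then obtain t where t: "t \<in> T l" "b * x - real t \<in> K l" using K_step by blast
      moreover have "x = f t (b * x - real t)" using b_gt_1 by (simp add: f_def)
      ultimately show "x \<in> (\<Union>t\<in>T l. f t ` closure (K l))" using closure_subset by blast
    qed
    have "bounded (K l)"
      using K_bounds by (intro boundedI[of _ "1 + H"]) auto
    then have "compact (closure (K l))" by (simp add: compact_closure)
    then have "compact (f t ` closure (K l))" for t
      unfolding f_def using b_gt_1 by (intro compact_continuous_image continuous_intros) auto
    then show "closed (\<Union>t\<in>T l. f t ` closure (K l))"
      using fin by (intro closed_UN) (auto intro: compact_imp_closed)
  qed
  then have step: "\<exists>t\<in>T l. b * x - real t \<in> closure (K l)" if x: "x \<in> closure (K l)" for x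
  proof -
    obtain t y where "t \<in> T l" "y \<in> closure (K l)" "x = f t y" using \<open>closure (K l) \<subseteq> _\<close> x by blast
    moreover from this have "b * x - real t = y" using b_gt_1 by (simp add: f_def)
    ultimately show ?thesis by (intro bexI[of _ t]) simp_all
  qed
  have "closure (K l) \<subseteq> {0..1 + H}"
    using K_bounds by (intro closure_minimal) auto
  then have bound: "\<bar>x\<bar> \<le> 1 + H" if "x \<in> closure (K l)" for x using that by auto
  have "closure (K l) \<subseteq> K l" using K_I[OF step bound] by blast
  then show ?thesis by (simp add: closure_subset_eq)
qed

text \<open>The digits form a complete residue system modulo \<open>2 l + 2\<close>, which makes the integer
  translates of \<open>K l\<close> cover the line.\<close>

lemma K_translates_approx:
  "\<exists>N :: int. \<exists>k\<in>K l. \<bar>u - k - of_int N\<bar> \<le> 1 / b ^ n"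
proof (induction n arbitrary: u)
  case 0
  have "\<bar>u - 0 - of_int \<lfloor>u\<rfloor>\<bar> \<le> 1 / b ^ 0" by simp linarith
  with zero_in_K show ?case by blast
next
  case (Suc n)
  obtain N k where k: "k \<in> K l" "\<bar>b * u - k - of_int N\<bar> \<le> 1 / b ^ n" using Suc by blast
  obtain t q where t: "t \<in> T l" "N = int t + int (2 * l + 2) * q" using T_residues by blast
  have N: "real_of_int N = real t + b * of_int q" unfolding t(2) b_def by simp
  have "(k + real t) / b \<in> K l" using t(1) k(1) b_gt_1 by (subst K_step) (auto intro!: bexI[of _ t])
  moreover have "u - (k + real t) / b - of_int q = (b * u - k - of_int N) / b"
    using b_gt_1 by (simp add: N field_simps)
  then have "\<bar>u - (k + real t) / b - of_int q\<bar> \<le> 1 / b ^ Suc n"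
    using k(2) b_gt_1 by (simp add: abs_divide field_simps)
  ultimately show ?case by blast
qed

text \<open>Only finitely many translates come near \<open>u\<close> and their union is closed, so
  the approximations become exact. The bounds on \<open>K l\<close> then leave just two
  translates.\<close>

lemma K_translates_cover:
  assumes "0 \<le> u" "u < 1"
  shows "u \<in> K l \<or> u + 1 \<in> K l"
proof -
  define S where "S = (\<Union>N\<in>{-3..3 :: int}. (\<lambda>k. k + of_int N) ` K l)"
  have "closed S"
    unfolding S_def using closed_K
    by (intro closed_UN) (simp_all add: closed_translation add.commute[of _ "of_int _"])
  moreover have "\<exists>y\<in>S. dist y u < e" if e: "0 < e" for e
  proof -
    obtain n where n: "(1 / b) ^ n < e" using real_arch_pow_inv[OF e, of "1 / b"] b_gt_1 by auto
    obtain N k where k: "k \<in> K l" "\<bar>u - k - of_int N\<bar> \<le> 1 / b ^ n"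
      using K_translates_approx by blast
    have "1 / b ^ n \<le> 1" using b_gt_1 by simp
    then have "-4 < real_of_int N" "real_of_int N < 4" using k assms K_bounds[OF k(1)] H_less_1 by linarith+
    then have "N \<in> {-3..3}" by auto
    then have "k + of_int N \<in> S" using k(1) by (auto simp: S_def)
    moreover have "dist (k + of_int N) u < e"
      using k(2) n by (simp add: dist_real_def power_divide abs_minus_commute)
    ultimately show ?thesis by blast
  qed
  ultimately have "u \<in> S" using closed_approachable by blast
  then obtain N k where N: "k \<in> K l" "u = k + of_int N" by (auto simp: S_def)
  have "-2 < real_of_int N" "real_of_int N < 1" using N assms K_bounds[OF N(1)] H_less_1 by linarith+
  then have "N = -1 \<or> N = 0" by linarith
  then show ?thesis using N by auto
qed

text \<open>Inside a hull of the Cantor part, \<open>K l\<close> looks like a scaled copy either of itself or of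
  \<open>K l - 1\<close>; the flag says which one.\<close>

definition local_K :: "bool \<Rightarrow> real \<Rightarrow> bool" where
  "local_K c w \<longleftrightarrow> (if c then w else w + 1) \<in> K l"

lemma K_digit_near:
  assumes "r - real t \<in> K l" "r = real d + w" "0 \<le> w" "w < 1"
  shows "t = d \<or> Suc t = d"
proof -
  have "real t \<le> real d + w" "real d + w < real t + 2"
    using K_bounds[OF assms(1)] H_less_1 assms(2) by linarith+
  then have "real t < real (Suc d)" "real d < real (t + 2)" using assms(3,4) by simp_all
  then have "t < Suc d" "d < t + 2" by linarith+
  then show ?thesis by linarith
qed

text \<open>After scaling by \<open>b\<close>, the digit to be stripped can only be \<open>e\<close>
  or \<open>e - 1\<close>. Exactly one of the two belongs to \<open>T l\<close>, and the flag and
  the parity of \<open>d\<close> decide which.\<close>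

lemma local_K_step:
  assumes "0 \<le> w" "w < 1" "d \<le> 2 * l"
  shows "local_K c ((real d + w) / b) \<longleftrightarrow> local_K (c = even d) w"
proof -
  \<comment> \<open>Scaling turns a shift by 1 into a shift by \<open>b\<close>, hence the added
    \<open>2 * l + 2\<close> for \<open>K l - 1\<close>.\<close>
  define e where "e = (if c then d else d + (2 * l + 2))"
  have "real e = (if c then real d else real d + b)" by (simp add: e_def b_def)
  then have "b * (if c then (real d + w) / b else (real d + w) / b + 1) = real e + w"
    using b_gt_1 by (simp add: distrib_left[of b _ 1])
  then have "local_K c ((real d + w) / b) \<longleftrightarrow> (\<exists>t\<in>T l. real e + w - real t \<in> K l)"
    unfolding local_K_def using K_step[of "if c then (real d + w) / b else (real d + w) / b + 1"] by simp
  also have "\<dots> \<longleftrightarrow> (e \<in> T l \<and> w \<in> K l) \<or> ((\<exists>t\<in>T l. Suc t = e) \<and> w + 1 \<in> K l)"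
    (is "?A \<longleftrightarrow> ?B")
  proof
    assume ?A
    then obtain t where t: "t \<in> T l" "real e + w - real t \<in> K l" by blast
    have "t = e \<or> Suc t = e" using K_digit_near[OF t(2) refl assms(1,2)] .
    with t show ?B by (auto simp: add.commute)
  next
    assume ?B
    then obtain t where "t \<in> T l" "t = e \<and> w \<in> K l \<or> Suc t = e \<and> w + 1 \<in> K l" by blast
    then show ?A by (intro bexI[of _ t]) (auto simp: add.commute)
  qed
  also have "e \<in> T l \<longleftrightarrow> (c = even d)"
    using assms(3) unfolding e_def T_iff by (cases c; simp; presburger)
  also have "(\<exists>t\<in>T l. Suc t = e) \<longleftrightarrow> e \<noteq> 0 \<and> e - 1 \<in> T l" by (cases e) auto
  also have "\<dots> \<longleftrightarrow> \<not> (c = even d)"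
    using assms(3) unfolding e_def T_iff by (cases c; simp; presburger)
  also have "(c = even d) \<and> w \<in> K l \<or> \<not> (c = even d) \<and> w + 1 \<in> K l \<longleftrightarrow> local_K (c = even d) w"
    unfolding local_K_def by simp
  finally show ?thesis .
qed

end

section \<open>Gaps and measure\<close>

context guthrie_nymann
begin

text \<open>Level 0 is the hull of \<open>K l\<close>. It splits by the units 0 and 1 into two
  intervals of length \<open>H\<close>; from then on the subintervals correspond to the base
  \<open>b\<close> digits from 0 to \<open>2 * l\<close>.\<close>

definition maxd :: "nat \<Rightarrow> nat" where "maxd n = (if n = 0 then 1 else 2 * l)"
definition sp :: "nat \<Rightarrow> real" where "sp n = 1 / b ^ n"
definition tau :: "nat \<Rightarrow> real" where "tau n = (if n = 0 then 1 + H else H / b ^ (n - 1))"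
text \<open>Used both as \<open>step\<close> and as \<open>hue\<close>: an odd digit flips the flag,
  and a gap is filled exactly when the subinterval before it has flag \<open>True\<close>. The flag
  thus records the parity of the digit sum.\<close>

definition hue :: "bool \<Rightarrow> nat \<Rightarrow> bool" where "hue c d \<longleftrightarrow> c = even d"

lemma tau_Suc: "tau (Suc n) = H / b ^ n"
  by (simp add: tau_def)

sublocale scheme: cantor_scheme maxd sp tau hue hue
proof
  fix n
  show "0 < maxd n" using l_pos by (simp add: maxd_def)
  show "tau n = real (maxd n) * sp n + tau (Suc n)"
  proof (cases n)
    case 0
    then show ?thesis by (simp add: tau_def maxd_def sp_def)
  next
    case (Suc m)
    have "H / b ^ m = b * H / b ^ Suc m" using b_gt_1 by simp
    then show ?thesis using b_H by (simp add: Suc tau_Suc maxd_def sp_def add_divide_distrib)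
  qed
  show "0 < tau n" using H_pos b_gt_1 by (simp add: tau_def)
  show "tau (Suc n) < sp n"
    using H_less_1 b_gt_1 by (simp add: tau_Suc sp_def divide_strict_right_mono)
  have "(\<lambda>n. H * (1 / b) ^ n) \<longlonglongrightarrow> H * 0"
    using b_gt_1 by (intro tendsto_mult tendsto_const LIMSEQ_realpow_zero) auto
  then have "(\<lambda>n. tau (Suc n)) \<longlonglongrightarrow> 0"
    by (simp add: tau_Suc power_divide)
  then show "tau \<longlonglongrightarrow> 0" by (rule LIMSEQ_imp_Suc)
qed

sublocale scheme: two_coloured_scheme maxd sp tau hue hue
proof
  have own: "\<exists>g\<in>scheme.gaps. scheme.colour g = a \<and> x < scheme.lower g \<and> scheme.upper g < x + tau (Suc n)"
    if st: "scheme.stage (Suc n) x c" for n x c a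
  proof -
    \<comment> \<open>The gaps after the first two subintervals have opposite colours; both exist
      because \<open>2 * l\<close> is at least 2.\<close>
    define d :: nat where "d = (if a = c then 0 else 1)"
    have d: "d < maxd (Suc n)" using l_pos by (simp add: d_def maxd_def)
    have "hue c d = a" by (auto simp: hue_def d_def)
    then show ?thesis
      using scheme.gap_in_stage(1,2)[OF d, of x] by (intro bexI[OF _ scheme.gapsI[OF st d]]) simp_all
  qed
  fix n x c a
  assume st: "scheme.stage n x c"
  show "\<exists>g\<in>scheme.gaps. scheme.colour g = a \<and> x < scheme.lower g \<and> scheme.upper g < x + tau n"
  proof (cases n)
    case 0
    \<comment> \<open>The whole hull splits only once, so both colours are sought one level further
      down.\<close>
    have "scheme.stage (Suc n) x (hue c 0)" using scheme.stage_Suc[OF st, of 0] by simp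
    from own[OF this, of a] obtain g where g: "g \<in> scheme.gaps" "scheme.colour g = a"
      "x < scheme.lower g" "scheme.upper g < x + tau (Suc n)" by blast
    have "tau (Suc n) \<le> tau n" using scheme.child_upper[of 0 n] by simp
    then have "scheme.upper g < x + tau n" using g(4) by linarith
    then show ?thesis using g(1-3) by blast
  next
    case (Suc m)
    show ?thesis using own[OF st[unfolded Suc], of a] unfolding Suc .
  qed
qed

text \<open>Iterates \<open>local_K_step\<close> along the digits. The induction starts at level 1,
  where the units 0 and 1 give precisely the two cases of \<open>local_K\<close>.\<close>

lemma stage_local_K:
  assumes "scheme.stage (Suc n) x c" "0 \<le> w" "w < 1"
  shows "x + w / b ^ n \<in> K l \<longleftrightarrow> local_K c w"
  using assms
proof (induction n arbitrary: x c w)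
  case 0
  obtain y c' d where "scheme.stage 0 y c'" "d \<le> maxd 0" and x: "x = y + real d * sp 0" "c = hue c' d"
    using 0(1) by (rule scheme.stage_SucE)
  then have "y = 0" "c'" "d = 0 \<or> d = 1" by (auto elim: scheme.stage.cases simp: maxd_def)
  then show ?case using x by (auto simp: sp_def hue_def local_K_def add.commute)
next
  case (Suc n)
  obtain y c' d where y: "scheme.stage (Suc n) y c'" "d \<le> maxd (Suc n)" "x = y + real d * sp (Suc n)" "c = hue c' d"
    using Suc.prems(1) by (rule scheme.stage_SucE)
  have d: "d \<le> 2 * l" using y(2) by (simp add: maxd_def)
  have "real d + w < b" using d Suc.prems(3) by (simp add: b_def)
  then have "0 \<le> (real d + w) / b" "(real d + w) / b < 1" using Suc.prems(2) b_gt_1 by simp_all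
  from Suc.IH[OF y(1) this] have "y + (real d + w) / b / b ^ n \<in> K l \<longleftrightarrow> local_K c' ((real d + w) / b)" .
  moreover have "y + (real d + w) / b / b ^ n = x + w / b ^ Suc n"
    by (simp add: y(3) sp_def add_divide_distrib)
  ultimately show ?case using local_K_step[OF Suc.prems(2,3) d, of c'] y(4) by (simp add: hue_def)
qed

text \<open>In local coordinates a gap is the interval from \<open>H\<close> to 1. There
  \<open>w + 1\<close> exceeds the maximum of \<open>K l\<close>, so the tiling forces
  \<open>w\<close> into \<open>K l\<close> and the flag alone decides.\<close>

lemma gap_in_K_iff:
  assumes "g \<in> scheme.gaps" "scheme.lower g < u" "u < scheme.upper g"
  shows "u \<in> K l \<longleftrightarrow> scheme.colour g"
proof -
  obtain n x c d where g: "scheme.stage n x c" "d < maxd n" "scheme.lower g = x + real d * sp n + tau (Suc n)"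
    "scheme.upper g = x + real (Suc d) * sp n" "scheme.colour g = hue c d"
    using assms(1) by (rule scheme.gapsE)
  define w where "w = (u - (x + real d * sp n)) * b ^ n"
  have u: "u = x + real d * sp n + w / b ^ n" using b_gt_1 by (simp add: w_def)
  have "H / b ^ n < w / b ^ n" "w / b ^ n < 1 / b ^ n"
    using assms(2,3) g(3,4) u by (simp_all add: tau_Suc sp_def distrib_right add_divide_distrib)
  then have w: "H < w" "w < 1" using b_gt_1 by (simp_all add: divide_less_cancel)
  have "w + 1 \<notin> K l" using K_bounds[of "w + 1"] w by auto
  moreover from this have "w \<in> K l" using K_translates_cover[of w] w H_pos by simp
  ultimately have "local_K a w \<longleftrightarrow> a" for a by (auto simp: local_K_def)
  moreover have "scheme.stage (Suc n) (x + real d * sp n) (hue c d)"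
    using g(1,2) by (intro scheme.stage_Suc) simp_all
  ultimately show ?thesis using stage_local_K[of n _ "hue c d" w] w H_pos u g(5) by simp
qed

text \<open>Points of gaps are settled by \<open>gap_in_K_iff\<close>. A point of the limit set is a
  limit of points in filled gaps, and \<open>K l\<close> is closed.\<close>

lemma K_eq_filled: "K l = scheme.filled"
proof (intro equalityI subsetI)
  fix x assume x: "x \<in> K l"
  then have "x \<in> {0..tau 0}" using K_bounds by (simp add: tau_def)
  moreover have "\<not> (scheme.lower g < x \<and> x < scheme.upper g)"
    if "g \<in> scheme.gaps" "\<not> scheme.colour g" for g
    using gap_in_K_iff[OF that(1), of x] that(2) x by blast
  ultimately show "x \<in> scheme.filled" unfolding scheme.filled_def by fastforce
next
  fix x assume "x \<in> scheme.filled"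
  then consider "x \<in> scheme.limit_set"
    | g where "g \<in> scheme.gaps" "scheme.colour g" "scheme.lower g < x" "x < scheme.upper g"
    unfolding scheme.filled_eq by auto
  then show "x \<in> K l"
  proof cases
    case 1
    have "\<exists>y\<in>K l. dist y x < e" if e: "0 < e" for e
    proof -
      obtain g where g: "g \<in> scheme.gaps" "scheme.colour g = True" "x - e < scheme.lower g" "scheme.upper g < x + e"
        using scheme.colour_near[OF 1 e] by blast
      obtain u where u: "scheme.lower g < u" "u < scheme.upper g"
        using dense scheme.gaps_inside(2)[OF g(1)] by blast
      then have "u \<in> K l" using gap_in_K_iff[OF g(1)] g(2) by blast
      moreover have "dist u x < e" using u g(3,4) unfolding dist_real_def by linarith
      ultimately show ?thesis by blast
    qed
    then show ?thesis using closed_approachable[OF closed_K] by blast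
  next
    case (2 g)
    then show ?thesis using gap_in_K_iff by blast
  qed
qed

lemma is_cantorval_K: "is_cantorval (K l)"
  unfolding K_eq_filled by (rule is_cantorval_filled[OF scheme.two_coloured_scheme_axioms])

lemma boundary_K: "K l - interior (K l) = scheme.limit_set"
  unfolding K_eq_filled by (rule scheme.filled_minus_interior)

text \<open>The overlap of \<open>K l\<close> and \<open>K l - 1\<close> is covered by \<open>2 l + 1\<close> copies of itself scaled by
  \<open>1 / (2 l + 2)\<close>.\<close>

lemma overlap_null: "emeasure lebesgue {u \<in> {0..<1}. u \<in> K l \<and> u + 1 \<in> K l} = 0"
proof -
  define D where "D = {u \<in> {0..<1}. u \<in> K l \<and> u + 1 \<in> K l}"
  have "{u. u + 1 \<in> K l} = (\<lambda>u. u + 1) -` K l" by auto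
  moreover have "closed \<dots>" by (intro continuous_closed_vimage closed_K) (auto intro!: continuous_intros)
  ultimately have "{u. u + 1 \<in> K l} \<in> sets borel" by simp
  moreover have "D = {0..<1} \<inter> K l \<inter> {u. u + 1 \<in> K l}" by (auto simp: D_def)
  ultimately have D_borel: "D \<in> sets borel" using closed_K by simp
  then have D_sets: "D \<in> sets lebesgue" by simp
  define E where "E d = D \<inter> {real d / b ..< real (Suc d) / b}" for d
  have E_sets: "E d \<in> sets lebesgue" for d using D_sets unfolding E_def by (rule sets.Int) simp
  have sub: "D \<subseteq> (\<Union>d\<in>{..2 * l}. E d)"
  proof
    fix u assume u: "u \<in> D"
    define d where "d = nat \<lfloor>b * u\<rfloor>"
    have bu: "0 \<le> b * u" using u b_gt_1 by (auto simp: D_def)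
    then have d: "real d \<le> b * u" "b * u < real (Suc d)" unfolding d_def by linarith+
    have "u \<le> H" using K_bounds[of "u + 1"] u by (auto simp: D_def)
    then have "b * u \<le> b * H" using b_gt_1 by simp
    then have "real d < real (2 * l + 1)" using d(1) b_H H_less_1 by linarith
    then have "d \<le> 2 * l" by simp
    moreover have "u \<in> E d" using u d b_gt_1 by (simp add: E_def field_simps)
    ultimately show "u \<in> (\<Union>d\<in>{..2 * l}. E d)" by blast
  qed
  \<comment> \<open>Stripping the digit \<open>d\<close> maps \<open>E d\<close> into the overlap:
    \<open>local_K\<close> holds at \<open>u\<close> for both flags, and \<open>local_K_step\<close>
    at most exchanges the flags.\<close>
  have E_le: "ennreal b * emeasure lebesgue (E d) \<le> emeasure lebesgue D" if d: "d \<le> 2 * l" for d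
  proof -
    have "(\<lambda>u. b *\<^sub>R u + - real d) ` E d \<subseteq> D"
    proof
      fix v assume "v \<in> (\<lambda>u. b *\<^sub>R u + - real d) ` E d"
      then obtain u where u: "u \<in> E d" "v = b * u - real d" by auto
      have v: "0 \<le> v" "v < 1" using u b_gt_1 by (auto simp: E_def field_simps)
      have "(real d + v) / b = u" using u b_gt_1 by simp
      then have "local_K c u \<longleftrightarrow> local_K (c = even d) v" for c
        using local_K_step[OF v d, of c] by simp
      moreover have "local_K True u" "local_K False u" using u(1) by (auto simp: E_def D_def local_K_def)
      ultimately have "local_K True v" "local_K False v" by (cases "even d"; metis)+
      then show "v \<in> D" using v by (simp add: D_def local_K_def)
    qed
    then have "emeasure lebesgue ((\<lambda>u. b *\<^sub>R u + - real d) ` E d) \<le> emeasure lebesgue D"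
      using D_sets by (rule emeasure_mono)
    then show ?thesis using b_gt_1 unfolding emeasure_lebesgue_affine by simp
  qed
  have "emeasure lebesgue D \<le> emeasure lebesgue {0..<1::real}"
    by (intro emeasure_mono) (auto simp: D_def)
  then have "emeasure lebesgue D \<le> 1" by simp
  \<comment> \<open>Finiteness of the measure makes the cancellation at the end legitimate:
    \<open>b * r\<close> is at most \<open>(b - 1) * r\<close> only for
    \<open>r = 0\<close>.\<close>
  then obtain r where r: "0 \<le> r" "emeasure lebesgue D = ennreal r"
    by (cases "emeasure lebesgue D") (auto simp: top_unique)
  have "emeasure lebesgue D \<le> emeasure lebesgue (\<Union>d\<in>{..2 * l}. E d)"
    using sub E_sets by (intro emeasure_mono) auto
  also have "\<dots> \<le> (\<Sum>d\<le>2 * l. emeasure lebesgue (E d))"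
    using E_sets by (intro emeasure_subadditive_finite) auto
  finally have "ennreal b * emeasure lebesgue D \<le> (\<Sum>d\<le>2 * l. ennreal b * emeasure lebesgue (E d))"
    by (simp add: sum_distrib_left[symmetric] mult_left_mono)
  also have "\<dots> \<le> (\<Sum>d\<le>2 * l. emeasure lebesgue D)" using E_le by (intro sum_mono) simp
  also have "\<dots> = ennreal (real (2 * l + 1) * r)" using r by (simp add: ennreal_mult ennreal_of_nat_eq_real_of_nat)
  finally have "b * r \<le> real (2 * l + 1) * r"
    using r b_gt_1 by (simp add: ennreal_mult[symmetric])
  then have "r = 0" using r(1) by (simp add: b_def distrib_right)
  then show ?thesis using r(2) by (simp add: D_def)
qed

text \<open>Cut \<open>K l\<close> at 1 and move the upper part back by 1. The two parts cover the
  unit interval and overlap in a null set.\<close>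

lemma emeasure_K: "emeasure lebesgue (K l) = 1"
proof -
  define A where "A = K l \<inter> {0..<1}"
  define B where "B = {u. u + 1 \<in> K l} \<inter> {0..<1}"
  define D where "D = {u \<in> {0..<1}. u \<in> K l \<and> u + 1 \<in> K l}"
  have K_sets: "K l \<in> sets lebesgue" using closed_K by simp
  have "{u. u + 1 \<in> K l} = (\<lambda>u. u + 1) -` K l" by auto
  moreover have "closed \<dots>" by (intro continuous_closed_vimage closed_K) (auto intro!: continuous_intros)
  ultimately have shift_sets: "{u. u + 1 \<in> K l} \<in> sets lebesgue" by simp
  have sets: "A \<in> sets lebesgue" "B \<in> sets lebesgue"
    unfolding A_def B_def using K_sets shift_sets by auto
  have D: "D = A \<inter> B" by (auto simp: A_def B_def D_def)
  then have D_null: "D \<in> null_sets lebesgue" using overlap_null sets unfolding D_def[symmetric] by auto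
  have shift: "K l - A = (\<lambda>u. 1 *\<^sub>R u + 1) ` B"
  proof (intro equalityI subsetI)
    fix x assume x: "x \<in> K l - A"
    then have "0 \<le> x" "x < 2" using K_bounds[of x] H_less_1 by auto
    with x have "x - 1 \<in> B" by (auto simp: A_def B_def)
    then show "x \<in> (\<lambda>u. 1 *\<^sub>R u + 1) ` B" by (intro image_eqI[of _ _ "x - 1"]) simp_all
  qed (auto simp: A_def B_def)
  have "emeasure lebesgue (K l) = emeasure lebesgue A + emeasure lebesgue (K l - A)"
    using sets(1) K_sets by (subst plus_emeasure) (auto simp: A_def intro!: arg_cong[of _ _ "emeasure lebesgue"])
  also have "emeasure lebesgue (K l - A) = emeasure lebesgue B"
    unfolding shift by (subst emeasure_lebesgue_affine) simp
  also have "\<dots> = emeasure lebesgue (B - D)" by (rule emeasure_Diff_null_set[OF D_null sets(2), symmetric])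
  also have "emeasure lebesgue A + \<dots> = emeasure lebesgue (A \<union> (B - D))"
    using sets D_null by (intro plus_emeasure) (auto simp: D)
  also have "A \<union> (B - D) = {0..<1}"
  proof (intro equalityI subsetI)
    fix u :: real assume "u \<in> {0..<1}"
    then show "u \<in> A \<union> (B - D)" using K_translates_cover[of u] unfolding D by (auto simp: A_def B_def)
  qed (auto simp: A_def B_def)
  finally show ?thesis by simp
qed

end

section \<open>Hausdorff dimension\<close>

text \<open>Padding the cover with empty sets costs nothing, since \<open>diam_pow\<close> is 0 on
  them even for exponent 0.\<close>

lemma hausdorff_content_le_finite_cover:
  assumes "finite I" "A \<subseteq> (\<Union>i\<in>I. V i)" "0 \<le> \<delta>"
    and small: "\<And>i. i \<in> I \<Longrightarrow> bounded (V i) \<and> diameter (V i) \<le> \<delta>"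
  shows "hausdorff_content \<delta> s A \<le> (\<Sum>i\<in>I. ennreal (diam_pow s (V i)))"
proof -
  obtain h where h: "bij_betw h {0..<card I} I" using ex_bij_betw_nat_finite[OF assms(1)] by blast
  define U where "U i = (if i < card I then V (h i) else {})" for i
  have hI: "h i \<in> I" if "i < card I" for i using h that by (auto simp: bij_betw_def)
  have "(\<Union>i\<in>I. V i) \<subseteq> (\<Union>i. U i)"
  proof
    fix x assume "x \<in> (\<Union>i\<in>I. V i)"
    then obtain j where j: "j \<in> I" "x \<in> V j" by blast
    then have "j \<in> h ` {0..<card I}" using bij_betw_imp_surj_on[OF h] by simp
    then obtain i where "i < card I" "h i = j" by auto
    then show "x \<in> (\<Union>i. U i)" using j by (intro UN_I[of i]) (auto simp: U_def)
  qed
  then have "A \<subseteq> (\<Union>i. U i)" using assms(2) by (rule order_trans[rotated])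
  moreover have "bounded (U i) \<and> diameter (U i) \<le> \<delta>" for i
    using small[OF hI, of i] assms(3) by (simp add: U_def)
  ultimately have "hausdorff_content \<delta> s A \<le> (\<Sum>i. ennreal (diam_pow s (U i)))"
    unfolding hausdorff_content_def by (intro Inf_lower) blast
  also have "\<dots> = (\<Sum>i\<in>{0..<card I}. ennreal (diam_pow s (U i)))"
    by (intro suminf_finite) (auto simp: U_def diam_pow_def)
  also have "\<dots> = (\<Sum>i\<in>{0..<card I}. ennreal (diam_pow s (V (h i))))"
    by (intro sum.cong) (simp_all add: U_def)
  also have "\<dots> = (\<Sum>i\<in>I. ennreal (diam_pow s (V i)))"
    by (rule sum.reindex_bij_betw[OF h])
  finally show ?thesis .
qed

section \<open>Upper bound for the dimension, by covers with intervals of one level\<close>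

context guthrie_nymann
begin

definition dimH :: real where "dimH = ln (real (2 * l + 1)) / ln (real (2 * l + 2))"

lemma dim_pos: "0 < dimH" and dim_less_1: "dimH < 1"
  using l_pos by (simp_all add: dimH_def)

lemma b_powr_dim: "b powr dimH = real (2 * l + 1)"
proof -
  have "ln b \<noteq> 0" using b_gt_1 by simp
  then show ?thesis using b_gt_1 by (simp add: powr_def dimH_def b_def)
qed

lemma b_power_powr: "(b ^ n) powr s = (b powr s) ^ n"
  using b_gt_1 by (simp add: powr_realpow[symmetric] powr_powr mult.commute)

lemma card_stage_le: "card {p. scheme.stage (Suc n) (fst p) (snd p)} \<le> 2 * (2 * l + 1) ^ n"
proof -
  have "(\<Prod>i<Suc n. Suc (maxd i)) = 2 * (2 * l + 1) ^ n"
    by (induction n) (simp_all add: maxd_def)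
  then show ?thesis using scheme.card_stage[of "Suc n"] by simp
qed

lemma content_limit_set_le:
  assumes "0 < s" "0 < \<delta>" "H / b ^ n \<le> \<delta>"
  shows "hausdorff_content \<delta> s scheme.limit_set
    \<le> ennreal (2 * H powr s * (real (2 * l + 1) / b powr s) ^ n)"
proof -
  define I where "I = {p. scheme.stage (Suc n) (fst p) (snd p)}"
  define V where "V p = {fst p .. fst p + H / b ^ n}" for p :: "real \<times> bool"
  have Hb: "0 < H / b ^ n" using H_pos b_gt_1 by simp
  have diam: "diameter (V p) = H / b ^ n" for p using Hb by (simp add: V_def)
  have "V p \<noteq> {}" for p using Hb by (auto simp: V_def)
  then have dp: "diam_pow s (V p) = (H / b ^ n) powr s" for p using assms(1) diam by (simp add: diam_pow_def)
  have cover: "scheme.limit_set \<subseteq> (\<Union>p\<in>I. V p)"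
  proof
    fix x assume "x \<in> scheme.limit_set"
    then obtain y c where "scheme.stage (Suc n) y c" "y \<le> x" "x \<le> y + tau (Suc n)"
      unfolding scheme.limit_set_iff by blast
    then show "x \<in> (\<Union>p\<in>I. V p)"
      by (intro UN_I[of "(y, c)"]) (simp_all add: I_def V_def tau_Suc)
  qed
  have "hausdorff_content \<delta> s scheme.limit_set \<le> (\<Sum>p\<in>I. ennreal (diam_pow s (V p)))"
    using cover assms(2,3) diam scheme.finite_stage[of "Suc n"]
    by (intro hausdorff_content_le_finite_cover) (simp_all add: I_def V_def)
  also have "\<dots> = ennreal (real (card I) * (H / b ^ n) powr s)"
    by (simp add: dp ennreal_mult ennreal_of_nat_eq_real_of_nat)
  also have "\<dots> \<le> ennreal (real (2 * (2 * l + 1) ^ n) * (H / b ^ n) powr s)"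
    using card_stage_le[of n] by (intro ennreal_leI mult_right_mono) (simp_all only: I_def of_nat_le_iff powr_ge_zero)
  also have "real (2 * (2 * l + 1) ^ n) * (H / b ^ n) powr s = 2 * H powr s * (real (2 * l + 1) / b powr s) ^ n"
    using H_pos b_gt_1 by (simp add: powr_divide b_power_powr power_divide)
  finally show ?thesis .
qed

text \<open>Above \<open>dimH\<close> the ratio in \<open>content_limit_set_le\<close> is less than
  1, so the content vanishes at every scale.\<close>

lemma hausdorff_measure_eq_0:
  assumes "dimH < s"
  shows "hausdorff_measure s scheme.limit_set = 0"
proof -
  define q where "q = real (2 * l + 1) / b powr s"
  have "b powr dimH < b powr s" using assms b_gt_1 by simp
  then have q: "0 < q" "q < 1" using b_gt_1 unfolding q_def b_powr_dim by simp_all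
  have "hausdorff_content \<delta> s scheme.limit_set = 0" if "0 < \<delta>" for \<delta>
  proof -
    have "(\<lambda>n. 2 * H powr s * q ^ n) \<longlonglongrightarrow> 2 * H powr s * 0"
      using q by (intro tendsto_mult tendsto_const LIMSEQ_realpow_zero) simp_all
    then have lim: "(\<lambda>n. ennreal (2 * H powr s * q ^ n)) \<longlonglongrightarrow> ennreal 0"
      by (intro tendsto_ennrealI) simp
    have "(\<lambda>n. tau (Suc n)) \<longlonglongrightarrow> 0" using scheme.tau_tendsto_0 by (rule LIMSEQ_Suc)
    then have "\<forall>\<^sub>F n in sequentially. tau (Suc n) < \<delta>" using that by (rule order_tendstoD)
    then have "\<forall>\<^sub>F n in sequentially. hausdorff_content \<delta> s scheme.limit_set \<le> ennreal (2 * H powr s * q ^ n)"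
    proof eventually_elim
      case (elim n)
      then show ?case
        using content_limit_set_le[of s \<delta> n] assms dim_pos that by (simp add: tau_Suc q_def)
    qed
    with lim have "hausdorff_content \<delta> s scheme.limit_set \<le> ennreal 0"
      by (rule tendsto_lowerbound[OF _ _ trivial_limit_sequentially])
    then show ?thesis by simp
  qed
  then show ?thesis unfolding hausdorff_measure_def by simp
qed

section \<open>Lower bound, by the Cantor function on the copy of the Cantor set starting at
  0\<close>

lemma expansion_in_limit_set:
  assumes d: "\<And>i. \<delta> i \<le> 2 * l"
  shows "expansion b \<delta> \<in> scheme.limit_set"
proof -
  have stage: "\<exists>c. scheme.stage (Suc n) (\<Sum>i<n. real (\<delta> i) / b ^ Suc i) c" for n
  proof (induction n)
    case 0
    show ?case using scheme.stage_Suc[OF scheme.stage_0, of 0] by auto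
  next
    case (Suc n)
    then obtain c where "scheme.stage (Suc n) (\<Sum>i<n. real (\<delta> i) / b ^ Suc i) c" by blast
    moreover have "\<delta> n \<le> maxd (Suc n)" using d[of n] by (simp add: maxd_def)
    ultimately have "scheme.stage (Suc (Suc n)) ((\<Sum>i<n. real (\<delta> i) / b ^ Suc i) + real (\<delta> n) * sp (Suc n)) (hue c (\<delta> n))"
      by (rule scheme.stage_Suc)
    moreover have "(\<Sum>i<n. real (\<delta> i) / b ^ Suc i) + real (\<delta> n) * sp (Suc n) = (\<Sum>i<Suc n. real (\<delta> i) / b ^ Suc i)"
      by (simp add: sp_def)
    ultimately show ?case by metis
  qed
  have "real (2 * l) / (b - 1) = H" by (simp add: b_def H_def)
  then have range: "0 \<le> expansion b (\<lambda>i. \<delta> (i + n))" "expansion b (\<lambda>i. \<delta> (i + n)) \<le> H" for n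
    using expansion_nonneg[OF b_gt_1, of "\<lambda>i. \<delta> (i + n)" "2 * l"]
      expansion_le[OF b_gt_1, of "\<lambda>i. \<delta> (i + n)" "2 * l"] d by simp_all
  have split: "expansion b \<delta> = (\<Sum>i<n. real (\<delta> i) / b ^ Suc i) + expansion b (\<lambda>i. \<delta> (i + n)) / b ^ n" for n
    by (rule expansion_split[OF b_gt_1 d])
  have tail: "0 \<le> expansion b (\<lambda>i. \<delta> (i + n)) / b ^ n" "expansion b (\<lambda>i. \<delta> (i + n)) / b ^ n \<le> tau (Suc n)" for n
    using range[of n] b_gt_1 by (simp_all add: tau_Suc divide_right_mono)
  have "\<exists>y c. scheme.stage n y c \<and> y \<le> expansion b \<delta> \<and> expansion b \<delta> \<le> y + tau n" for n
  proof (cases n)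
    case 0
    then show ?thesis
      using range[of 0] scheme.stage_0 by (intro exI[of _ 0] exI[of _ True]) (simp add: tau_def)
  next
    case (Suc m)
    obtain c where "scheme.stage n (\<Sum>i<m. real (\<delta> i) / b ^ Suc i) c" using stage[of m] Suc by blast
    moreover have "(\<Sum>i<m. real (\<delta> i) / b ^ Suc i) \<le> expansion b \<delta>"
      "expansion b \<delta> \<le> (\<Sum>i<m. real (\<delta> i) / b ^ Suc i) + tau n"
      using split[of m] tail[of m] unfolding Suc by linarith+
    ultimately show ?thesis by blast
  qed
  then show ?thesis unfolding scheme.limit_set_iff by blast
qed

text \<open>Reading the digits in base \<open>2 l + 1\<close> instead of \<open>2 l + 2\<close> is the Cantor function; it is
  Hoelder continuous with exponent \<open>dimH\<close>.\<close>

lemma cantor_function_hoelder: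
  assumes d: "\<And>i. \<delta> i \<le> 2 * l" and e: "\<And>i. \<epsilon> i \<le> 2 * l"
  shows "\<bar>expansion (real (2 * l + 1)) \<delta> - expansion (real (2 * l + 1)) \<epsilon>\<bar>
    \<le> (b * real (2 * l + 1)) powr dimH * \<bar>expansion b \<delta> - expansion b \<epsilon>\<bar> powr dimH"
proof (cases "\<delta> = \<epsilon>")
  case False
  define B where "B = real (2 * l + 1)"
  have B: "1 < B" using l_pos by (simp add: B_def)
  define k where "k = (LEAST k. \<delta> k \<noteq> \<epsilon> k)"
  have k: "\<delta> k \<noteq> \<epsilon> k" unfolding k_def by (rule LeastI_ex) (use False in auto)
  have before: "\<delta> i = \<epsilon> i" if "i < k" for i using not_less_Least that unfolding k_def by blast
  have prefix: "(\<Sum>i<k. real (\<delta> i) / c ^ Suc i) = (\<Sum>i<k. real (\<epsilon> i) / c ^ Suc i)" for c :: real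
    by (rule sum.cong) (simp_all add: before)

  have "real (2 * l) / (B - 1) = 1" using l_pos by (simp add: B_def)
  then have unit: "0 \<le> expansion B (\<lambda>i. f (i + k)) \<and> expansion B (\<lambda>i. f (i + k)) \<le> 1"
    if "\<And>i. f i \<le> 2 * l" for f
    using expansion_nonneg[OF B, of "\<lambda>i. f (i + k)" "2 * l"]
      expansion_le[OF B, of "\<lambda>i. f (i + k)" "2 * l"] that by simp
  have "expansion B \<delta> - expansion B \<epsilon> = (expansion B (\<lambda>i. \<delta> (i + k)) - expansion B (\<lambda>i. \<epsilon> (i + k))) / B ^ k"
    using expansion_split[OF B, of \<delta> "2 * l" k, OF d] expansion_split[OF B, of \<epsilon> "2 * l" k, OF e] prefix[of B]
    unfolding diff_divide_distrib by linarith
  moreover have "\<bar>expansion B (\<lambda>i. \<delta> (i + k)) - expansion B (\<lambda>i. \<epsilon> (i + k))\<bar> \<le> 1"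
    using unit[of \<delta>, OF d] unit[of \<epsilon>, OF e] by linarith
  ultimately have upper: "\<bar>expansion B \<delta> - expansion B \<epsilon>\<bar> \<le> 1 / B ^ k"
    using B by (simp add: abs_divide divide_right_mono)

  define X where "X f = expansion b (\<lambda>i. f (i + Suc k))" for f
  have "real (2 * l) / (b - 1) = H" by (simp add: b_def H_def)
  then have X: "0 \<le> X f \<and> X f \<le> H" if "\<And>i. f i \<le> 2 * l" for f
    using expansion_nonneg[OF b_gt_1, of "\<lambda>i. f (i + Suc k)" "2 * l"]
      expansion_le[OF b_gt_1, of "\<lambda>i. f (i + Suc k)" "2 * l"] that by (simp add: X_def)
  have "expansion b \<delta> - expansion b \<epsilon> = (real (\<delta> k) - real (\<epsilon> k) + (X \<delta> - X \<epsilon>)) / b ^ Suc k"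
    using expansion_split[OF b_gt_1, of \<delta> "2 * l" "Suc k", OF d] expansion_split[OF b_gt_1, of \<epsilon> "2 * l" "Suc k", OF e] prefix[of b]
    unfolding sum.lessThan_Suc X_def diff_divide_distrib add_divide_distrib by linarith
  then have "\<bar>expansion b \<delta> - expansion b \<epsilon>\<bar> = \<bar>real (\<delta> k) - real (\<epsilon> k) + (X \<delta> - X \<epsilon>)\<bar> / b ^ Suc k"
    using b_gt_1 by (simp add: abs_divide)
  moreover have "1 \<le> \<bar>real (\<delta> k) - real (\<epsilon> k)\<bar>" using k by linarith
  \<comment> \<open>At the first disagreement the digits differ by at least 1, while both tails lie
    between 0 and \<open>H\<close>.\<close>
  then have "1 - H \<le> \<bar>real (\<delta> k) - real (\<epsilon> k) + (X \<delta> - X \<epsilon>)\<bar>"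
    using X[of \<delta>, OF d] X[of \<epsilon>, OF e] by linarith
  ultimately have "(1 - H) / b ^ Suc k \<le> \<bar>expansion b \<delta> - expansion b \<epsilon>\<bar>"
    using b_gt_1 by (simp add: divide_right_mono del: power_Suc)
  then have "b * B * ((1 - H) / b ^ Suc k) \<le> b * B * \<bar>expansion b \<delta> - expansion b \<epsilon>\<bar>"
    using B b_gt_1 by (intro mult_left_mono) simp_all
  \<comment> \<open>This identity explains the constant \<open>b * B\<close>: it turns the
    separation \<open>(1 - H) / b ^ Suc k\<close> into \<open>1 / b ^ k\<close>.\<close>
  moreover have "B * (1 - H) = 1" by (simp add: B_def H_def field_simps)
  then have "b * B * ((1 - H) / b ^ Suc k) = 1 / b ^ k"
    using b_gt_1 by (simp add: mult.assoc)
  ultimately have "(1 / b ^ k) powr dimH \<le> (b * B * \<bar>expansion b \<delta> - expansion b \<epsilon>\<bar>) powr dimH"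
    using b_gt_1 dim_pos by (intro powr_mono2) simp_all
  also have "\<dots> = (b * B) powr dimH * \<bar>expansion b \<delta> - expansion b \<epsilon>\<bar> powr dimH"
    by (rule powr_mult)
  \<comment> \<open>The exponent solves \<open>b powr dimH = B\<close>, which converts one scale
    into the other.\<close>
  also have "(1 / b ^ k) powr dimH = 1 / B ^ k"
    using b_gt_1 by (simp add: powr_divide b_power_powr b_powr_dim B_def)
  finally show ?thesis using upper by (simp add: B_def)
qed simp

lemma cantor_function_onto:
  assumes "0 \<le> y" "y < 1"
  shows "\<exists>\<delta>. (\<forall>i. \<delta> i \<le> 2 * l) \<and> y = expansion (real (2 * l + 1)) \<delta>"
proof -
  have B: "1 < real (2 * l + 1)" using l_pos by simp
  have "\<exists>t\<in>{..2 * l}. real (2 * l + 1) * y - real t \<in> {0..<1}" if y: "y \<in> {0..<1}" for y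
  proof
    define t where "t = nat \<lfloor>real (2 * l + 1) * y\<rfloor>"
    have "0 \<le> real (2 * l + 1) * y" using y by simp
    then have t: "real t \<le> real (2 * l + 1) * y" "real (2 * l + 1) * y < real t + 1"
      unfolding t_def by linarith+
    then show "real (2 * l + 1) * y - real (nat \<lfloor>real (2 * l + 1) * y\<rfloor>) \<in> {0..<1}"
      unfolding t_def[symmetric] atLeastLessThan_iff by linarith
    have "real (2 * l + 1) * y < real (2 * l + 1) * 1"
      using y B by (intro mult_strict_left_mono) simp_all
    with t(1) have "real t < real (2 * l + 1) * 1" by (rule le_less_trans)
    then show "nat \<lfloor>real (2 * l + 1) * y\<rfloor> \<in> {..2 * l}" unfolding t_def[symmetric] by simp
  qed
  from expansion_exists[OF B this, of 1 y] assms show ?thesis by auto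
qed

text \<open>The Cantor function carries a cover of the limit set to a cover of the unit interval by
  sets of length at most \<open>2 * C\<close> times \<open>diam_pow s\<close>, so the sum over the
  cover is at least \<open>1 / (2 * C)\<close>.\<close>

lemma hausdorff_measure_pos:
  assumes s: "0 \<le> s" "s \<le> dimH"
  shows "hausdorff_measure s scheme.limit_set \<noteq> 0"
proof -
  define C where "C = (b * real (2 * l + 1)) powr dimH"
  have C: "0 < C" using b_gt_1 by (simp add: C_def)
  have "ennreal (1 / (2 * C)) \<le> (\<Sum>i. ennreal (diam_pow s (U i)))"
    if cover: "scheme.limit_set \<subseteq> (\<Union>i. U i)" and U: "\<And>i. bounded (U i) \<and> diameter (U i) \<le> 1"
    for U :: "nat \<Rightarrow> real set"
  proof -
    \<comment> \<open>The image of \<open>U i\<close> under the Cantor function, expressed through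
      digit sequences so that no expansion has to be chosen for a point.\<close>
    define V where "V i = {expansion (real (2 * l + 1)) \<delta> | \<delta>. (\<forall>j. \<delta> j \<le> 2 * l) \<and> expansion b \<delta> \<in> U i}" for i
    have "\<exists>W. W \<in> sets lborel \<and> V i \<subseteq> W \<and> emeasure lborel W \<le> ennreal (2 * C) * ennreal (diam_pow s (U i))" for i
    proof (cases "V i = {}")
      case True
      then show ?thesis by (intro exI[of _ "{}"]) simp
    next
      case False
      then obtain \<delta> where d: "\<And>j. \<delta> j \<le> 2 * l" "expansion b \<delta> \<in> U i" by (auto simp: V_def)
      define r where "r = C * diameter (U i) powr dimH"
      have diam: "0 \<le> diameter (U i)" "diameter (U i) \<le> 1" using U diameter_ge_0 by auto
      \<comment> \<open>The diameter is at most 1, so a smaller exponent cannot decrease the power;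
        for \<open>s = 0\<close> the value is 1 by definition.\<close>
      have "diameter (U i) powr dimH \<le> diam_pow s (U i)"
      proof (cases "s = 0")
        case True
        then show ?thesis using d(2) diam dim_pos powr_mono2[of dimH "diameter (U i)" 1] by (auto simp: diam_pow_def)
      next
        case False
        then show ?thesis using d(2) diam s powr_mono'[of s dimH "diameter (U i)"] by (auto simp: diam_pow_def)
      qed
      then have r: "0 \<le> r" "2 * r \<le> 2 * C * diam_pow s (U i)" using C by (simp_all add: r_def)
      \<comment> \<open>The centre is the image of one point of \<open>U i\<close>; by the Hoelder
        bound all other images lie within \<open>r\<close> of it.\<close>
      define v where "v = expansion (real (2 * l + 1)) \<delta>"
      have "V i \<subseteq> {v - r .. v + r}"
      proof
        fix y assume "y \<in> V i"
        then obtain \<epsilon> where e: "\<And>j. \<epsilon> j \<le> 2 * l" "expansion b \<epsilon> \<in> U i" "y = expansion (real (2 * l + 1)) \<epsilon>"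
          by (auto simp: V_def)
        have "dist (expansion b \<epsilon>) (expansion b \<delta>) \<le> diameter (U i)"
          using U d(2) e(2) by (intro diameter_bounded_bound) auto
        then have "\<bar>expansion b \<epsilon> - expansion b \<delta>\<bar> powr dimH \<le> diameter (U i) powr dimH"
          using dim_pos by (intro powr_mono2) (simp_all add: dist_real_def)
        then have "C * \<bar>expansion b \<epsilon> - expansion b \<delta>\<bar> powr dimH \<le> r"
          unfolding r_def using C by (intro mult_left_mono) simp_all
        then have "\<bar>y - v\<bar> \<le> r"
          using cantor_function_hoelder[of \<epsilon> \<delta>, OF e(1) d(1)] unfolding C_def e(3) v_def by linarith
        then show "y \<in> {v - r .. v + r}" by auto
      qed
      moreover have "emeasure lborel {v - r .. v + r} = ennreal (2 * r)" using r(1) by simp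
      moreover have "ennreal (2 * r) \<le> ennreal (2 * C) * ennreal (diam_pow s (U i))"
        using r(2) C by (simp add: ennreal_mult'[symmetric] ennreal_leI)
      ultimately show ?thesis by (intro exI[of _ "{v - r .. v + r}"]) simp
    qed
    then obtain W where W: "\<And>i. W i \<in> sets lborel" "\<And>i. V i \<subseteq> W i"
      "\<And>i. emeasure lborel (W i) \<le> ennreal (2 * C) * ennreal (diam_pow s (U i))" by metis
    have "{0..<1} \<subseteq> (\<Union>i. W i)"
    proof
      fix y :: real assume "y \<in> {0..<1}"
      then obtain \<delta> where d: "\<And>i. \<delta> i \<le> 2 * l" "y = expansion (real (2 * l + 1)) \<delta>"
        using cantor_function_onto[of y] by auto
      then obtain i where "expansion b \<delta> \<in> U i" using expansion_in_limit_set[of \<delta>] cover by blast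
      then have "y \<in> V i" using d by (auto simp: V_def)
      then show "y \<in> (\<Union>i. W i)" using W(2) by blast
    qed
    then have "emeasure lborel {0..<1::real} \<le> emeasure lborel (\<Union>i. W i)"
      using W(1) by (intro emeasure_mono) auto
    also have "\<dots> \<le> (\<Sum>i. emeasure lborel (W i))"
      using W(1) by (intro emeasure_subadditive_countably) auto
    also have "\<dots> \<le> (\<Sum>i. ennreal (2 * C) * ennreal (diam_pow s (U i)))"
      by (intro suminf_le W(3) summableI)
    also have "\<dots> = ennreal (2 * C) * (\<Sum>i. ennreal (diam_pow s (U i)))" by simp
    finally have "1 \<le> ennreal (2 * C) * (\<Sum>i. ennreal (diam_pow s (U i)))" by simp
    then have "ennreal (1 / (2 * C)) * 1 \<le> ennreal (1 / (2 * C)) * (ennreal (2 * C) * (\<Sum>i. ennreal (diam_pow s (U i))))"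
      by (rule mult_left_mono) simp
    also have "\<dots> = ennreal (1 / (2 * C) * (2 * C)) * (\<Sum>i. ennreal (diam_pow s (U i)))"
      using C by (subst ennreal_mult) (simp_all add: mult.assoc)
    also have "1 / (2 * C) * (2 * C) = 1" using C by simp
    finally show ?thesis by simp
  qed
  then have "ennreal (1 / (2 * C)) \<le> hausdorff_content 1 s scheme.limit_set"
    unfolding hausdorff_content_def by (intro Inf_greatest) blast
  also have "\<dots> \<le> hausdorff_measure s scheme.limit_set"
    unfolding hausdorff_measure_def by (intro SUP_upper) simp
  finally show ?thesis using C by auto
qed

lemma hausdorff_dim_limit_set: "hausdorff_dim scheme.limit_set = ereal dimH"
proof (rule antisym)
  show "ereal dimH \<le> hausdorff_dim scheme.limit_set"
    unfolding hausdorff_dim_def using hausdorff_measure_pos by (intro Inf_greatest) force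
  show "hausdorff_dim scheme.limit_set \<le> ereal dimH"
  proof (rule ccontr)
    assume "\<not> ?thesis"
    then have "ereal dimH < hausdorff_dim scheme.limit_set" by simp
    from ereal_dense2[OF this] obtain s
      where s: "ereal dimH < ereal s" "ereal s < hausdorff_dim scheme.limit_set" by blast
    then have "hausdorff_dim scheme.limit_set \<le> ereal s"
      unfolding hausdorff_dim_def using dim_pos hausdorff_measure_eq_0[of s]
      by (intro Inf_lower) auto
    with s(2) show False by simp
  qed
qed

lemma dim_not_integer: "dimH \<notin> \<int>"
proof
  assume "dimH \<in> \<int>"
  then obtain k :: int where "dimH = of_int k" by (rule Ints_cases)
  then show False using dim_pos dim_less_1 by simp
qed

end

theorem theorem1:
  fixes l :: nat
  assumes "l \<ge> 1"
  shows "is_cantorval (K l)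
    \<and> emeasure lebesgue (K l) = 1
    \<and> hausdorff_dim (K l - interior (K l)) = ereal (ln (real (2 * l + 1)) / ln (real (2 * l + 2)))
    \<and> ln (real (2 * l + 1)) / ln (real (2 * l + 2)) \<notin> \<int>"
proof -
  interpret guthrie_nymann l by unfold_locales fact
  show ?thesis
    using is_cantorval_K emeasure_K hausdorff_dim_limit_set dim_not_integer
    unfolding boundary_K dimH_def by blast
qed

end
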